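(* Let $k\geq 3$ be an integer, and let $\mathbb{H}$ be a $k$-uniform hypergraph (with no isolated vertices and with girth greater than $4$, so that the hypergraph semiring $S_{\mathbb{H}}$ is defined). Then $S_{\mathbb{H}}$ and $S_{\mathbb{H}}^0$ are both nonfinitely based.
   Context: An ai-semiring is an algebra $(S,+,\cdot)$ with two binary operations (no constants in the signature) such that $(S,+)$ is a commutative idempotent semigroup, $(S,\cdot)$ is a semigroup, and $x(y+z)\approx xy+xz$, $(x+y)z\approx xz+yz$ hold. An ai-semiring is finitely based if the variety it generates can be defined by a finite set of identities, and nonfinitely based otherwise. For an ai-semiring $S$, $S^0=S\cup\{0\}$ is the ai-semiring obtained by adjoining a new element $0$ with $s+0=0+s=s$ and $s0=0s=0$ for all $s\in S\cup\{0\}$, the operations on $S$ being preserved. (If $S$ already has an element called $0$, the adjoined one is a different new element.) A hypergraph is a pair $(V,E)$ with $E$ a family of nonempty subsets (hyperedges) of a set $V$ (of vertices); it is $k$-uniform if every hyperedge has $k$ elements. A vertex is isolated if it lies in no hyperedge. A subhyperedge is a subset of $V$ contained in some hyperedge. A cycle of length $n\geq 2$ is an alternating sequence $v_0,e_1,v_1,\dots,e_n,v_n$ with $v_0=v_n$, $v_0,\dots,v_{n-1}$ distinct vertices, $e_1,\dots,e_n$ distinct hyperedges, and $\{v_{i-1},v_i\}\subseteq e_i$ for $1\leq i\leq n$. The girth is the length of a shortest cycle ($\infty$ if there is none). For a $k$-uniform hypergraph $\mathbb{H}=(V,E)$ ($k\geq 3$) with no isolated vertices and girth greater than $4$, the hypergraph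 semiring $S_{\mathbb{H}}$ is the flat semiring whose multiplicative semigroup is generated by $\{\mathbf{a}_v\mid v\in V\}$ (in one-to-one correspondence with $V$) together with an element $0$, subject to the relations: (1) $0$ is a multiplicative zero; (2) $\mathbf{a}_u\mathbf{a}_v=\mathbf{a}_v\mathbf{a}_u$ for all $u,v\in V$; (3) $\mathbf{a}_u\mathbf{a}_v=0$ if $u=v$ or $\{u,v\}$ is not a subhyperedge; (4) $\mathbf{a}_{u_1}\cdots\mathbf{a}_{u_k}=\mathbf{a}_{v_1}\cdots\mathbf{a}_{v_k}$ for all hyperedges $\{u_1,\dots,u_k\},\{v_1,\dots,v_k\}\in E$; (5) $\mathbf{a}_{u_1}\cdots\mathbf{a}_{u_{k-1}}=\mathbf{a}_{v_1}\cdots\mathbf{a}_{v_{k-1}}$ whenever there is $w\in V$ with $\{u_1,\dots,u_{k-1},w\},\{v_1,\dots,v_{k-1},w\}\in E$. Its addition is $x+x=x$ and $x+y=0$ for $x\neq y$ (this is an ai-semiring because the multiplicative semigroup is $0$-cancellative). *)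

theory Defs
  imports Main "HOL-Library.Extended_Nat"
begin

section \<open>Algebras with two binary operations and their identities\<close>

record 'a alg =
  carrier :: "'a set"
  add :: "'a \<Rightarrow> 'a \<Rightarrow> 'a"
  mul :: "'a \<Rightarrow> 'a \<Rightarrow> 'a"

definition algebra :: "'a alg \<Rightarrow> bool" where
  "algebra A \<longleftrightarrow> carrier A \<noteq> {} \<and>
     (\<forall>x\<in>carrier A. \<forall>y\<in>carrier A. add A x y \<in> carrier A \<and> mul A x y \<in> carrier A)"

datatype trm = Var nat | Add trm trm | Mul trm trm

type_synonym identity = "trm \<times> trm"

primrec eval :: "'a alg \<Rightarrow> (nat \<Rightarrow> 'a) \<Rightarrow> trm \<Rightarrow> 'a" where
  "eval A h (Var n) = h n"
| "eval A h (Add s t) = add A (eval A h s) (eval A h t)"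
| "eval A h (Mul s t) = mul A (eval A h s) (eval A h t)"

definition satisfies :: "'a alg \<Rightarrow> identity \<Rightarrow> bool" where
  "satisfies A p \<longleftrightarrow>
     (\<forall>h. range h \<subseteq> carrier A \<longrightarrow> eval A h (fst p) = eval A h (snd p))"

definition models :: "identity set \<Rightarrow> 'u alg set" where
  "models \<Sigma> = {A. algebra A \<and> (\<forall>p\<in>\<Sigma>. satisfies A p)}"

definition identities_of :: "'a alg \<Rightarrow> identity set" where
  "identities_of S = {p. satisfies S p}"

text \<open>
  A variety is a class of algebras defined by identities. The smallest one containing \<open>S\<close>
  is defined by all the identities of \<open>S\<close>. As HOL cannot quantify over all types,
  its members are taken with carriers in a universe \<open>'u\<close> (unrelated to the type of \<open>S\<close>).
\<close>

definition variety_generated_by :: "'a alg \<Rightarrow> 'u alg set" where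
  "variety_generated_by S = models (identities_of S)"

text \<open>
  The universe has to be infinite for this to be the usual notion; any infinite one will do,
  because two varieties with the same countable members coincide.
  The axioms of ai-semirings are finitely many identities, so that it makes
  no difference whether \<open>\<Sigma>\<close> has to define the variety of an ai-semiring
  among all algebras of the signature, as here, or among ai-semirings only.
\<close>

definition finitely_based :: "'u itself \<Rightarrow> 'a alg \<Rightarrow> bool" where
  "finitely_based _ S \<longleftrightarrow>
     (\<exists>\<Sigma>. finite \<Sigma> \<and> (variety_generated_by S :: 'u alg set) = models \<Sigma>)"

text \<open>The algebra \<open>S\<^sup>0\<close>: the adjoined element \<open>None\<close> is neutral for addition
  and absorbing for multiplication.\<close>

fun add0 :: "('a \<Rightarrow> 'a \<Rightarrow> 'a) \<Rightarrow> 'a option \<Rightarrow> 'a option \<Rightarrow> 'a option" where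
  "add0 f None y = y"
| "add0 f x None = x"
| "add0 f (Some x) (Some y) = Some (f x y)"

fun mul0 :: "('a \<Rightarrow> 'a \<Rightarrow> 'a) \<Rightarrow> 'a option \<Rightarrow> 'a option \<Rightarrow> 'a option" where
  "mul0 f None y = None"
| "mul0 f x None = None"
| "mul0 f (Some x) (Some y) = Some (f x y)"

definition adjoin_zero :: "'a alg \<Rightarrow> 'a option alg" where
  "adjoin_zero S =
     \<lparr>carrier = insert None (Some ` carrier S), add = add0 (add S), mul = mul0 (mul S)\<rparr>"


section \<open>Hypergraphs\<close>

definition hypergraph :: "'v set \<Rightarrow> 'v set set \<Rightarrow> bool" where
  "hypergraph V E \<longleftrightarrow> (\<forall>e\<in>E. e \<noteq> {} \<and> e \<subseteq> V)"

definition uniform :: "nat \<Rightarrow> 'v set set \<Rightarrow> bool" where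
  "uniform k E \<longleftrightarrow> (\<forall>e\<in>E. finite e \<and> card e = k)"

definition isolated :: "'v set set \<Rightarrow> 'v \<Rightarrow> bool" where
  "isolated E v \<longleftrightarrow> (\<forall>e\<in>E. v \<notin> e)"

definition subhyperedge :: "'v set \<Rightarrow> 'v set set \<Rightarrow> 'v set \<Rightarrow> bool" where
  "subhyperedge V E s \<longleftrightarrow> s \<subseteq> V \<and> (\<exists>e\<in>E. s \<subseteq> e)"

text \<open>The cycle \<open>v 0, e 1, v 1, \<dots>, e n, v n\<close>; values of \<open>v\<close> and \<open>e\<close> at other indices
  are irrelevant.\<close>

definition is_cycle ::
  "'v set \<Rightarrow> 'v set set \<Rightarrow> nat \<Rightarrow> (nat \<Rightarrow> 'v) \<Rightarrow> (nat \<Rightarrow> 'v set) \<Rightarrow> bool" where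
  "is_cycle V E n v e \<longleftrightarrow> n \<ge> 2 \<and> v 0 = v n \<and>
     v ` {0..<n} \<subseteq> V \<and> inj_on v {0..<n} \<and>
     e ` {1..n} \<subseteq> E \<and> inj_on e {1..n} \<and>
     (\<forall>i\<in>{1..n}. {v (i - 1), v i} \<subseteq> e i)"

text \<open>In \<open>enat\<close>, the infimum of the empty set is \<open>\<infinity>\<close>.\<close>

definition girth :: "'v set \<Rightarrow> 'v set set \<Rightarrow> enat" where
  "girth V E = Inf {enat n | n. \<exists>v e. is_cycle V E n v e}"


section \<open>The hypergraph semiring\<close>

datatype 'v gen = Zero | Gen 'v

text \<open>The free semigroup on the generators: nonempty words.\<close>

definition words :: "'v set \<Rightarrow> 'v gen list set" where
  "words V = {w. w \<noteq> [] \<and> set w \<subseteq> insert Zero (Gen ` V)}"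

text \<open>The congruence on \<open>words V\<close> generated by the defining relations. In \<open>edge\<close> and \<open>link\<close>,
  hyperedges are listed without repetition; in a \<open>k\<close>-uniform hypergraph the lists
  \<open>us\<close> and \<open>vs\<close> thus have length \<open>k\<close> in \<open>edge\<close> and \<open>k - 1\<close> in \<open>link\<close>.\<close>

inductive hcong :: "'v set \<Rightarrow> 'v set set \<Rightarrow> 'v gen list \<Rightarrow> 'v gen list \<Rightarrow> bool"
  for V :: "'v set" and E :: "'v set set" where
  refl: "w \<in> words V \<Longrightarrow> hcong V E w w"
| sym: "hcong V E w w' \<Longrightarrow> hcong V E w' w"
| trans: "hcong V E w w' \<Longrightarrow> hcong V E w' w'' \<Longrightarrow> hcong V E w w''"
| mult: "hcong V E u u' \<Longrightarrow> hcong V E w w' \<Longrightarrow> hcong V E (u @ w) (u' @ w')"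
| zero_left: "w \<in> words V \<Longrightarrow> hcong V E (Zero # w) [Zero]"
| zero_right: "w \<in> words V \<Longrightarrow> hcong V E (w @ [Zero]) [Zero]"
| comm: "u \<in> V \<Longrightarrow> v \<in> V \<Longrightarrow> hcong V E [Gen u, Gen v] [Gen v, Gen u]"
| null: "u \<in> V \<Longrightarrow> v \<in> V \<Longrightarrow> u = v \<or> \<not> subhyperedge V E {u, v} \<Longrightarrow>
    hcong V E [Gen u, Gen v] [Zero]"
| edge: "distinct us \<Longrightarrow> set us \<in> E \<Longrightarrow> distinct vs \<Longrightarrow> set vs \<in> E \<Longrightarrow>
    hcong V E (map Gen us) (map Gen vs)"
| link: "w \<in> V \<Longrightarrow> distinct (us @ [w]) \<Longrightarrow> set (us @ [w]) \<in> E \<Longrightarrow>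
    distinct (vs @ [w]) \<Longrightarrow> set (vs @ [w]) \<in> E \<Longrightarrow>
    hcong V E (map Gen us) (map Gen vs)"

definition hrel :: "'v set \<Rightarrow> 'v set set \<Rightarrow> ('v gen list \<times> 'v gen list) set" where
  "hrel V E = {(w, w'). hcong V E w w'}"

definition hypergraph_semiring :: "'v set \<Rightarrow> 'v set set \<Rightarrow> 'v gen list set alg" where
  "hypergraph_semiring V E =
     \<lparr>carrier = words V // hrel V E,
      add = (\<lambda>X Y. if X = Y then X else hrel V E `` {[Zero]}),
      mul = (\<lambda>X Y. \<Union>u\<in>X. \<Union>w\<in>Y. hrel V E `` {u @ w})\<rparr>"


section \<open>Well-definedness\<close>

lemma words_append: "u \<in> words V \<Longrightarrow> w \<in> words V \<Longrightarrow> u @ w \<in> words V"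
  by (auto simp: words_def)

lemma map_Gen_words: "map Gen xs \<in> words V \<longleftrightarrow> xs \<noteq> [] \<and> set xs \<subseteq> V"
  by (auto simp: words_def)

lemma hcong_words:
  assumes H: "hypergraph V E" "uniform k E" "k \<ge> 2" and "hcong V E w w'"
  shows "w \<in> words V \<and> w' \<in> words V"
proof -
  have edge_sub: "xs \<noteq> [] \<and> set xs \<subseteq> V" if "set xs \<in> E" for xs
    using H(1) that unfolding hypergraph_def by force
  have link_sub: "xs \<noteq> [] \<and> set xs \<subseteq> V" if "set (xs @ [x]) \<in> E" for xs x
  proof -
    have "card (set (xs @ [x])) = k"
      using H(2) that unfolding uniform_def by blast
    with H(3) have "xs \<noteq> []" by (cases xs) simp_all
    with edge_sub[OF that] show ?thesis by simp
  qed
  have z: "[Zero] \<in> words V" by (simp add: words_def)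
  show ?thesis
    using assms(4)
  proof (induction rule: hcong.induct)
    case (zero_left w)
    then show ?case using words_append[OF z] z by simp
  next
    case (edge us vs)
    show ?case unfolding map_Gen_words
      using edge_sub[OF edge(2)] edge_sub[OF edge(4)] by (rule conjI)
  next
    case (link w us vs)
    show ?case unfolding map_Gen_words
      using link_sub[OF link(3)] link_sub[OF link(5)] by (rule conjI)
  qed (simp_all add: z words_append, simp_all add: words_def)
qed

lemma equiv_hrel:
  assumes "hypergraph V E" "uniform k E" "k \<ge> 2"
  shows "equiv (words V) (hrel V E)"
proof (rule equivI)
  show "hrel V E \<subseteq> words V \<times> words V"
    using hcong_words[OF assms] by (auto simp: hrel_def)
  show "refl_on (words V) (hrel V E)"
    by (auto simp: refl_on_def hrel_def intro: hcong.refl)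
  show "sym (hrel V E)"
    by (rule symI) (simp add: hrel_def hcong.sym)
  show "trans (hrel V E)"
    by (rule transI) (simp add: hrel_def, rule hcong.trans)
qed

lemma mul_class:
  assumes "hypergraph V E" "uniform k E" "k \<ge> 2" "u \<in> words V" "w \<in> words V"
  shows "mul (hypergraph_semiring V E) (hrel V E `` {u}) (hrel V E `` {w}) =
    hrel V E `` {u @ w}"
proof -
  have "congruent2 (hrel V E) (hrel V E) (\<lambda>u w. hrel V E `` {u @ w})"
  proof (unfold congruent2_def, clarify)
    fix u u' w w'
    assume "(u, u') \<in> hrel V E" "(w, w') \<in> hrel V E"
    then have "(u @ w, u' @ w') \<in> hrel V E"
      by (auto simp: hrel_def intro: hcong.mult)
    then show "hrel V E `` {u @ w} = hrel V E `` {u' @ w'}"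
      by (rule equiv_class_eq[OF equiv_hrel[OF assms(1-3)]])
  qed
  from UN_equiv_class2[OF equiv_hrel[OF assms(1-3)] equiv_hrel[OF assms(1-3)] this assms(4,5)]
  show ?thesis by (simp add: hypergraph_semiring_def)
qed

lemma algebra_hypergraph_semiring:
  assumes "hypergraph V E" "uniform k E" "k \<ge> 2"
  shows "algebra (hypergraph_semiring V E)"
proof -
  have c: "carrier (hypergraph_semiring V E) = words V // hrel V E"
    by (simp add: hypergraph_semiring_def)
  have z: "[Zero] \<in> words V" by (simp add: words_def)
  have "mul (hypergraph_semiring V E) X Y \<in> words V // hrel V E"
    if XY: "X \<in> words V // hrel V E" "Y \<in> words V // hrel V E" for X Y
  proof -
    obtain u where u: "u \<in> words V" "X = hrel V E `` {u}" using XY(1) by (rule quotientE)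
    obtain w where w: "w \<in> words V" "Y = hrel V E `` {w}" using XY(2) by (rule quotientE)
    show ?thesis
      unfolding u(2) w(2) mul_class[OF assms u(1) w(1)]
      by (rule quotientI[OF words_append[OF u(1) w(1)]])
  qed
  moreover have "add (hypergraph_semiring V E) X Y \<in> words V // hrel V E"
    if "X \<in> words V // hrel V E" for X Y
    using that quotientI[OF z, of "hrel V E"] by (auto simp: hypergraph_semiring_def)
  moreover have "words V // hrel V E \<noteq> {}"
    using quotientI[OF z, of "hrel V E"] by auto
  ultimately show ?thesis
    unfolding algebra_def c by simp
qed

end

theory Submission
  imports Defs "HOL-Library.Countable" "HOL-Library.Multiset"
begin

text \<open>
  The reason is the one behind graph-colouring proofs of nonfinite axiomatisability: a hypergraph
  \<open>G\<close> can look \<open>k\<close>-colourable on every small set of hyperedges and still have no homomorphism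
  to the given hypergraph \<open>H\<close> (\<open>k\<close> and \<open>H\<close> as in the theorem).

  A \<open>k\<close>-uniform hypergraph \<open>G\<close> is encoded by the term \<open>t\<close> that sums the products of the variables
  along its hyperedges. A nonzero value of \<open>t\<close> in the semiring \<open>S\<close> of \<open>H\<close> makes all these products
  equal and nonzero; since a nonzero word has at most \<open>k\<close> letters, every variable goes to
  a single generator, and the assignment is a homomorphism \<open>G \<rightarrow> H\<close> (\<open>eval_sparse_hypergraph\<close>).
  If there is none, \<open>t\<close> is constantly \<open>0\<close> on \<open>S\<close>, the largest element for addition, so \<open>t\<close> absorbs
  any summand: \<open>t \<approx> t + w\<close> holds in \<open>S\<close>. If moreover \<open>w\<close> contains every variable of \<open>t\<close>, the
  identity holds in \<open>S\<^sup>0\<close> too, because an assignment that sends some variable to the new element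
  sends \<open>w\<close> to it as well (\<open>sparse_identity\<close>).

  This identity does not follow from identities of \<open>S\<close> whose sides have few words. Terms are
  compared by the contexts that complete all their words to listings of hyperedges of \<open>G\<close>; this is
  a congruence \<open>R\<close> on terms, and \<open>w\<close>, having too many letters, separates \<open>t\<close> from \<open>t + w\<close>.
  To see that \<open>R\<close> contains every instance of a small identity \<open>p \<approx> q\<close> of \<open>S\<close>, suppose that all
  words on the left complete to listings and some word on the right does not. Only one choice of
  a word for each variable matters, so few hyperedges of \<open>G\<close> are involved on the left. Colour them with
  the vertices of one hyperedge of \<open>H\<close>, each injectively, so that the bad word on the right does not become a listing.
  The colouring is an assignment in \<open>S\<close>, and it contradicts \<open>p \<approx> q\<close>
  (\<open>listing_context_transfer\<close>).

  It remains to find \<open>G\<close>. Take a generalised Mycielskian of a long odd cycle: any \<open>n\<close> of its edges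
  form a bipartite graph (\<open>few_arcs_bipartite\<close>), but it has no map to any set that is proper and
  identifies two opposite vertices of every \<open>4\<close>-cycle (\<open>quadrangle_obstruction\<close>): the cycle,
  run through twice, is homotopic to a point across \<open>4\<close>-cycles. Its edges
  are enlarged to \<open>k\<close>-sets. As the girth of \<open>H\<close> exceeds \<open>4\<close>, a homomorphism to \<open>H\<close> would be such
  a map (\<open>no_homomorphism\<close>).
\<close>

section \<open>Finite bases and congruences on terms\<close>

instance trm :: countable
  by countable_datatype

primrec subst :: "(nat \<Rightarrow> trm) \<Rightarrow> trm \<Rightarrow> trm" where
  "subst \<theta> (Var n) = \<theta> n"
| "subst \<theta> (Add s t) = Add (subst \<theta> s) (subst \<theta> t)"
| "subst \<theta> (Mul s t) = Mul (subst \<theta> s) (subst \<theta> t)"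

definition congruence :: "(trm \<Rightarrow> trm \<Rightarrow> bool) \<Rightarrow> bool" where
  "congruence R \<longleftrightarrow> equivp R \<and>
     (\<forall>s s' t t'. R s s' \<longrightarrow> R t t' \<longrightarrow> R (Add s t) (Add s' t') \<and> R (Mul s t) (Mul s' t'))"

lemma eval_subst: "eval A h (subst \<theta> t) = eval A (\<lambda>n. eval A h (\<theta> n)) t"
  by (induction t) simp_all

lemma eval_in_carrier:
  assumes "algebra A" "range h \<subseteq> carrier A"
  shows "eval A h t \<in> carrier A"
  using assms by (induction t) (auto simp: algebra_def)

text \<open>There are only countably many terms, so the quotient of the term algebra by a congruence
  has a copy on any infinite type.\<close>

lemma quotient_algebra:
  assumes inf: "infinite (UNIV :: 'u set)" and R: "congruence R"
  obtains A :: "'u alg" and r :: "trm \<Rightarrow> 'u"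
  where "algebra A" "\<And>s t. r s = r t \<longleftrightarrow> R s t"
    "\<And>p. satisfies A p \<longleftrightarrow> (\<forall>\<theta>. R (subst \<theta> (fst p)) (subst \<theta> (snd p)))"
proof -
  from R have eqv: "equivp R"
    and R_Add: "\<And>s s' t t'. R s s' \<Longrightarrow> R t t' \<Longrightarrow> R (Add s t) (Add s' t')"
    and R_Mul: "\<And>s s' t t'. R s s' \<Longrightarrow> R t t' \<Longrightarrow> R (Mul s t) (Mul s' t')"
    by (auto simp: congruence_def)
  obtain j :: "nat \<Rightarrow> 'u" where j: "inj j"
    using infinite_countable_subset[OF inf] by blast
  define rep where "rep t = (SOME s. R t s)" for t
  have R_rep: "R t (rep t)" for t
    unfolding rep_def by (rule someI[of _ t]) (rule equivp_reflp[OF eqv])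
  have rep_eq: "rep s = rep t \<longleftrightarrow> R s t" for s t
  proof
    assume "rep s = rep t"
    then show "R s t"
      using R_rep[of s] R_rep[of t] equivp_symp[OF eqv] equivp_transp[OF eqv] by metis
  next
    assume "R s t"
    then have "R s = R t"
      using eqv by (simp add: equivp_def)
    then show "rep s = rep t" by (simp add: rep_def)
  qed
  define r where "r t = j (to_nat (rep t))" for t
  have r_eq: "r s = r t \<longleftrightarrow> R s t" for s t
    using rep_eq[of s t] inj_eq[OF j] by (simp add: r_def)
  define u where "u = inv r"
  have R_u: "R (u (r t)) t" for t
    using r_eq[of "u (r t)" t] by (simp add: u_def f_inv_into_f)
  define A where "A = \<lparr>carrier = range r, add = (\<lambda>x y. r (Add (u x) (u y))),
      mul = (\<lambda>x y. r (Mul (u x) (u y)))\<rparr>"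
  have carr: "carrier A = range r" by (simp add: A_def)
  have alg: "algebra A" by (auto simp: algebra_def A_def)
  have ev: "eval A (r \<circ> \<theta>) t = r (subst \<theta> t)" for \<theta> t
    by (induction t) (auto simp: A_def r_eq intro!: R_Add R_Mul R_u)
  have "satisfies A p \<longleftrightarrow> (\<forall>\<theta>. R (subst \<theta> (fst p)) (subst \<theta> (snd p)))" for p
  proof
    assume sat: "satisfies A p"
    have "eval A (r \<circ> \<theta>) (fst p) = eval A (r \<circ> \<theta>) (snd p)" for \<theta>
    proof -
      have "range (r \<circ> \<theta>) \<subseteq> carrier A" by (auto simp: carr)
      with sat show ?thesis unfolding satisfies_def by simp
    qed
    then show "\<forall>\<theta>. R (subst \<theta> (fst p)) (subst \<theta> (snd p))"
      by (simp add: ev r_eq)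
  next
    assume *: "\<forall>\<theta>. R (subst \<theta> (fst p)) (subst \<theta> (snd p))"
    show "satisfies A p" unfolding satisfies_def
    proof (intro allI impI)
      fix h :: "nat \<Rightarrow> 'u" assume "range h \<subseteq> carrier A"
      then have h: "h = r \<circ> (u \<circ> h)"
        by (auto simp: carr u_def fun_eq_iff f_inv_into_f image_subset_iff)
      show "eval A h (fst p) = eval A h (snd p)"
        by (subst (1 2) h) (simp only: ev r_eq *)
    qed
  qed
  with that alg r_eq show thesis by blast
qed

lemma congruence_identities:
  assumes "algebra S"
  shows "congruence (\<lambda>s t. (s, t) \<in> identities_of S)"
  unfolding congruence_def identities_of_def satisfies_def
  by (auto intro!: equivpI reflpI sympI transpI)

lemma identities_subst:
  assumes "algebra S" "(s, t) \<in> identities_of S"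
  shows "(subst \<theta> s, subst \<theta> t) \<in> identities_of S"
  using assms eval_in_carrier[OF assms(1)]
  by (auto simp: identities_of_def satisfies_def eval_subst image_subset_iff)

text \<open>Birkhoff's completeness theorem in the form needed here: a finite basis must consist of
  identities of \<open>S\<close> (look at the quotient by all identities of \<open>S\<close>), and a congruence that
  contains all substitution instances of the basis contains all identities of \<open>S\<close>.\<close>

lemma not_finitely_basedI:
  assumes inf: "infinite (UNIV :: 'u set)" and S: "algebra S"
    and ex: "\<And>\<Sigma>. finite \<Sigma> \<Longrightarrow> \<Sigma> \<subseteq> identities_of S \<Longrightarrow>
      \<exists>R. congruence R \<and> (\<forall>p\<in>\<Sigma>. \<forall>\<theta>. R (subst \<theta> (fst p)) (subst \<theta> (snd p))) \<and>
          (\<exists>p\<in>identities_of S. \<not> R (fst p) (snd p))"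
  shows "\<not> finitely_based TYPE('u) S"
proof
  assume "finitely_based TYPE('u) S"
  then obtain \<Sigma> where \<Sigma>: "finite \<Sigma>"
    and eq: "models (identities_of S) = (models \<Sigma> :: 'u alg set)"
    by (auto simp: finitely_based_def variety_generated_by_def)
  have "\<Sigma> \<subseteq> identities_of S"
  proof
    fix p assume p: "p \<in> \<Sigma>"
    obtain A :: "'u alg" where A: "algebra A" and sat: "\<And>p. satisfies A p \<longleftrightarrow>
        (\<forall>\<theta>. (subst \<theta> (fst p), subst \<theta> (snd p)) \<in> identities_of S)"
      using quotient_algebra[OF inf congruence_identities[OF S]] by metis
    have "A \<in> models (identities_of S)"
      using A sat identities_subst[OF S] by (auto simp: models_def)
    with eq p have "satisfies A p" by (auto simp: models_def)
    then have "(subst Var (fst p), subst Var (snd p)) \<in> identities_of S"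
      using sat by blast
    moreover have "subst Var t = t" for t by (induction t) simp_all
    ultimately show "p \<in> identities_of S" by simp
  qed
  with ex[OF \<Sigma>] obtain R q where R: "congruence R"
    and inst: "\<And>p \<theta>. p \<in> \<Sigma> \<Longrightarrow> R (subst \<theta> (fst p)) (subst \<theta> (snd p))"
    and q: "q \<in> identities_of S" "\<not> R (fst q) (snd q)"
    by blast
  obtain A :: "'u alg" where A: "algebra A"
    and sat: "\<And>p. satisfies A p \<longleftrightarrow> (\<forall>\<theta>. R (subst \<theta> (fst p)) (subst \<theta> (snd p)))"
    using quotient_algebra[OF inf R] by metis
  have "A \<in> models \<Sigma>"
    using A sat inst by (simp add: models_def)
  with eq q(1) have "satisfies A q" by (auto simp: models_def)
  then have "R (subst Var (fst q)) (subst Var (snd q))"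
    using sat by blast
  moreover have "subst Var t = t" for t by (induction t) simp_all
  ultimately show False using q(2) by simp
qed


section \<open>Terms as sets of words\<close>

primrec expand :: "(nat \<Rightarrow> 'b list) \<Rightarrow> trm \<Rightarrow> 'b list set" where
  "expand g (Var x) = {g x}"
| "expand g (Add s t) = expand g s \<union> expand g t"
| "expand g (Mul s t) = (\<Union>u\<in>expand g s. \<Union>v\<in>expand g t. {u @ v})"

lemma expand_nonempty: "expand g t \<noteq> {}"
  by (induction t) auto

lemma finite_expand: "finite (expand g t)"
  by (induction t) auto

lemma expand_concat: "expand g t = (\<lambda>v. concat (map g v)) ` expand (\<lambda>x. [x]) t"
  by (induction t) (auto simp: image_Un image_UN)

lemma expand_map: "expand (\<lambda>x. map f (g x)) t = map f ` expand g t"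
  by (induction t) (auto simp: image_Un image_UN)

lemma expand_subst_mono:
  assumes "\<And>x. g x \<in> expand d (\<theta> x)"
  shows "expand g t \<subseteq> expand d (subst \<theta> t)"
  using assms by (induction t) auto

text \<open>Different occurrences of a variable may contribute different words of its substituted term.\<close>

lemma expand_subst_cases:
  "w \<in> expand d (subst \<theta> t) \<Longrightarrow> \<exists>v ws. v \<in> expand (\<lambda>x. [x]) t \<and>
     list_all2 (\<lambda>x u. u \<in> expand d (\<theta> x)) v ws \<and> w = concat ws"
proof (induction t arbitrary: w)
  case (Var x)
  then show ?case by (intro exI[of _ "[x]"] exI[of _ "[w]"]) simp
next
  case (Add s t)
  from Add.prems have "w \<in> expand d (subst \<theta> s) \<or> w \<in> expand d (subst \<theta> t)" by simp
  then show ?case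
  proof
    assume "w \<in> expand d (subst \<theta> s)"
    from Add.IH(1)[OF this] show ?thesis by (auto intro: UnI1)
  next
    assume "w \<in> expand d (subst \<theta> t)"
    from Add.IH(2)[OF this] show ?thesis by (auto intro: UnI2)
  qed
next
  case (Mul s t)
  then obtain w1 w2 where w: "w1 \<in> expand d (subst \<theta> s)" "w2 \<in> expand d (subst \<theta> t)" "w = w1 @ w2"
    by auto
  obtain v1 ws1 where 1: "v1 \<in> expand (\<lambda>x. [x]) s"
    "list_all2 (\<lambda>x u. u \<in> expand d (\<theta> x)) v1 ws1" "w1 = concat ws1"
    using Mul.IH(1)[OF w(1)] by blast
  obtain v2 ws2 where 2: "v2 \<in> expand (\<lambda>x. [x]) t"
    "list_all2 (\<lambda>x u. u \<in> expand d (\<theta> x)) v2 ws2" "w2 = concat ws2"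
    using Mul.IH(2)[OF w(2)] by blast
  show ?case
    using 1 2 w(3)
    by (intro exI[of _ "v1 @ v2"] exI[of _ "ws1 @ ws2"]) (auto simp: list_all2_appendI)
qed

text \<open>A word without repeated variables imposes at most one condition on the choice for each variable.\<close>

lemma distinct_choice:
  assumes "distinct v" "list_all2 P v ws" "\<And>x. \<exists>u. P x u"
  shows "\<exists>g. (\<forall>x. P x (g x)) \<and> map g v = ws"
  using assms(2,1)
proof (induction rule: list_all2_induct)
  case Nil
  show ?case using assms(3) by (auto intro: choice)
next
  case (Cons x v u ws)
  then obtain g where g: "\<forall>x. P x (g x)" "map g v = ws" by auto
  have "map (g(x := u)) (x # v) = u # ws"
    using Cons.prems g(2) by auto
  moreover have "\<forall>y. P y ((g(x := u)) y)"
    using g(1) Cons.hyps by simp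
  ultimately show ?case by (intro exI[of _ "g(x := u)"] conjI)
qed

text \<open>The syntactic congruence of \<open>L\<close>, with the sum of words read as their conjunction.\<close>

definition word_congruence :: "(nat \<Rightarrow> 'b) \<Rightarrow> 'b list set \<Rightarrow> trm \<Rightarrow> trm \<Rightarrow> bool" where
  "word_congruence d L s t \<longleftrightarrow> (\<forall>a b. (\<forall>w\<in>expand (\<lambda>x. [d x]) s. a @ w @ b \<in> L) \<longleftrightarrow>
     (\<forall>w\<in>expand (\<lambda>x. [d x]) t. a @ w @ b \<in> L))"

lemma congruence_word_congruence: "congruence (word_congruence d L)"
proof -
  let ?W = "expand (\<lambda>x. [d x])"
  have mul: "(\<forall>w\<in>?W (Mul s t). a @ w @ b \<in> L) \<longleftrightarrow>
      (\<forall>v\<in>?W t. \<forall>u\<in>?W s. a @ u @ (v @ b) \<in> L)"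
    "(\<forall>w\<in>?W (Mul s t). a @ w @ b \<in> L) \<longleftrightarrow>
      (\<forall>u\<in>?W s. \<forall>v\<in>?W t. (a @ u) @ v @ b \<in> L)" for s t a b
    by auto
  have "word_congruence d L (Mul s t) (Mul s' t')"
    if "word_congruence d L s s'" "word_congruence d L t t'" for s s' t t'
  proof -
    have "word_congruence d L (Mul s t) (Mul s' t)"
      using that(1) unfolding word_congruence_def mul(1) by blast
    moreover have "word_congruence d L (Mul s' t) (Mul s' t')"
      using that(2) unfolding word_congruence_def mul(2) by blast
    ultimately show ?thesis by (simp add: word_congruence_def)
  qed
  moreover have "word_congruence d L (Add s t) (Add s' t')"
    if "word_congruence d L s s'" "word_congruence d L t t'" for s s' t t'
    using that by (simp add: word_congruence_def ball_Un)
  ultimately show ?thesis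
    unfolding congruence_def
    by (auto intro!: equivpI reflpI sympI transpI simp: word_congruence_def)
qed

fun product :: "nat list \<Rightarrow> trm" where
  "product [] = Var 0"
| "product [x] = Var x"
| "product (x # y # xs) = Mul (Var x) (product (y # xs))"

fun sum_of_products :: "nat list list \<Rightarrow> trm" where
  "sum_of_products [] = Var 0"
| "sum_of_products [w] = product w"
| "sum_of_products (w # w' # ws) = Add (product w) (sum_of_products (w' # ws))"

lemma expand_product: "w \<noteq> [] \<Longrightarrow> expand g (product w) = {concat (map g w)}"
  by (induction w rule: product.induct) simp_all

lemma expand_sum_of_products:
  "ws \<noteq> [] \<Longrightarrow> [] \<notin> set ws \<Longrightarrow>
    expand g (sum_of_products ws) = (\<lambda>w. concat (map g w)) ` set ws"
  by (induction ws rule: sum_of_products.induct) (auto simp: expand_product)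

section \<open>A sparse hypergraph without homomorphisms\<close>

text \<open>\<open>Node l i\<close> is the vertex of the graph on level \<open>l\<close> in column \<open>i\<close>. Every edge \<open>x y\<close> of the graph
  gets a third vertex \<open>Mid x y\<close> of its own, while the vertices \<open>Pad i\<close> lie in all hyperedges:
  in a colouring by \<open>k\<close> colours they use up \<open>k - 3\<close> of them, which leaves three.\<close>

datatype vert = Node nat nat | Apex | Mid vert vert | Pad nat

instance vert :: countable
  by countable_datatype

text \<open>Odd, and so long that \<open>n\<close> edges cannot meet all positions along the cycle.\<close>

definition perimeter :: "nat \<Rightarrow> nat" where "perimeter n = 2 * n + 3"

definition node :: "nat \<Rightarrow> nat \<Rightarrow> nat \<Rightarrow> vert" where
  "node n l i = Node l (i mod perimeter n)"

lemma node_mod: "node n l (i mod perimeter n) = node n l i" "node n l (Suc (i mod perimeter n)) = node n l (Suc i)"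
  by (simp_all add: node_def mod_Suc_eq)

text \<open>An odd cycle on level \<open>0\<close>, copies of its edges crossing between consecutive levels up to
  \<open>n + 1\<close>, and an apex joined to the last level.\<close>

definition arcs :: "nat \<Rightarrow> (vert \<times> vert) set" where
  "arcs n = (\<lambda>i. (node n 0 i, node n 0 (Suc i))) ` {..<perimeter n} \<union>
    (\<lambda>(l, i). (node n l i, node n (Suc l) (Suc i))) ` ({..n} \<times> {..<perimeter n}) \<union>
    (\<lambda>(l, i). (node n l (Suc i), node n (Suc l) i)) ` ({..n} \<times> {..<perimeter n}) \<union>
    (\<lambda>i. (node n (Suc n) i, Apex)) ` {..<perimeter n}"

definition adjacent :: "nat \<Rightarrow> vert \<Rightarrow> vert \<Rightarrow> bool" where
  "adjacent n x y \<longleftrightarrow> (x, y) \<in> arcs n \<or> (y, x) \<in> arcs n"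

lemma finite_arcs: "finite (arcs n)"
  by (auto simp: arcs_def)

lemma perimeter_pos: "0 < perimeter n"
  by (simp add: perimeter_def)

lemma adjacent_sym: "adjacent n x y \<Longrightarrow> adjacent n y x"
  by (auto simp: adjacent_def)

lemma adjacent_ring: "adjacent n (node n 0 i) (node n 0 (Suc i))"
proof -
  have "(node n 0 (i mod perimeter n), node n 0 (Suc (i mod perimeter n))) \<in> arcs n"
    using perimeter_pos[of n] unfolding arcs_def by (intro UnI1 imageI) simp
  then show ?thesis by (simp add: adjacent_def node_mod)
qed

lemma adjacent_up: "l \<le> n \<Longrightarrow> adjacent n (node n l i) (node n (Suc l) (Suc i))"
proof -
  assume l: "l \<le> n"
  have "(\<lambda>(l, i). (node n l i, node n (Suc l) (Suc i))) (l, i mod perimeter n) \<in> arcs n"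
    using perimeter_pos[of n] l unfolding arcs_def by (intro UnI1 UnI2 imageI) simp
  then show ?thesis by (simp add: adjacent_def node_mod)
qed

lemma adjacent_down: "l \<le> n \<Longrightarrow> adjacent n (node n l (Suc i)) (node n (Suc l) i)"
proof -
  assume l: "l \<le> n"
  have "(\<lambda>(l, i). (node n l (Suc i), node n (Suc l) i)) (l, i mod perimeter n) \<in> arcs n"
    using perimeter_pos[of n] l unfolding arcs_def by (rule_tac UnI1, intro UnI2 imageI) simp
  then show ?thesis by (simp add: adjacent_def node_mod)
qed

lemma adjacent_apex: "adjacent n (node n (Suc n) i) Apex"
proof -
  have "(node n (Suc n) (i mod perimeter n), Apex) \<in> arcs n"
    using perimeter_pos[of n] unfolding arcs_def by (intro UnI2 imageI) simp
  then show ?thesis by (simp add: adjacent_def node_mod)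
qed

lemma arcs_nonempty: "arcs n \<noteq> {}"
  using adjacent_apex[of n 0] by (auto simp: adjacent_def)

text \<open>Some gap between levels \<open>m\<close> and \<open>m + 1\<close> is crossed by no edge of \<open>F\<close>. Above the gap the
  levels alternate. Below it the columns alternate, once the cycle of columns is cut
  at a position \<open>j\<close> where \<open>F\<close> has no edge.\<close>

lemma few_arcs_bipartite:
  assumes F: "F \<subseteq> arcs n" "card F \<le> n"
  shows "\<exists>f :: vert \<Rightarrow> bool. \<forall>x y. (x, y) \<in> F \<longrightarrow> f x \<noteq> f y"
proof -
  have fin: "finite F" using F(1) finite_arcs by (rule finite_subset)
  \<comment> \<open>the gap that an edge crosses and the position of its columns; \<open>n + 1\<close> and \<open>perimeter n\<close>
    stand for none\<close>
  define lev where "lev = (\<lambda>(x, y). case x of Node l i \<Rightarrow> (case y of Node l' i' \<Rightarrow>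
    if l = l' then n + 1 else l | _ \<Rightarrow> n + 1) | _ \<Rightarrow> n + 1)"
  define col where "col = (\<lambda>(x, y). case x of Node l i \<Rightarrow> (case y of Node l' i' \<Rightarrow>
    if i' = Suc i mod perimeter n then i else i' | _ \<Rightarrow> perimeter n) | _ \<Rightarrow> perimeter n)"
  have small: "card (g ` F) < card {..n}" for g :: "vert \<times> vert \<Rightarrow> nat"
    using card_image_le[OF fin, of g] F(2) by simp
  have "\<not> {..n} \<subseteq> g ` F" for g :: "vert \<times> vert \<Rightarrow> nat"
    using small[of g] card_mono[of "g ` F" "{..n}"] fin by auto
  then obtain m j where m: "m \<le> n" "m \<notin> lev ` F" and j: "j \<le> n" "j \<notin> col ` F"
    by (meson atMost_iff subsetI)
  have jN: "Suc j < perimeter n" using j by (simp add: perimeter_def)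
  define f where "f v = (case v of
      Node l i \<Rightarrow> if l \<le> m then even i \<noteq> (i > j) else even l
    | _ \<Rightarrow> even n)" for v
  have step: "(even (i mod perimeter n) \<noteq> (i mod perimeter n > j)) \<noteq> (even (Suc i mod perimeter n) \<noteq> (Suc i mod perimeter n > j))"
    if "i < perimeter n" "i \<noteq> j" for i
  proof (cases "Suc i = perimeter n")
    case True
    moreover have "even i" using True by (simp add: perimeter_def)
    ultimately show ?thesis using jN by auto
  next
    case False
    then show ?thesis using that by (auto simp: mod_less)
  qed
  \<comment> \<open>hence \<open>col\<close> can tell a step forward from a step back\<close>
  have twostep: "i \<noteq> Suc (Suc i mod perimeter n) mod perimeter n" if "i < perimeter n" for i
    using that by (auto simp: mod_Suc perimeter_def)
  show ?thesis
  proof (intro exI[of _ f] allI impI)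
    fix x y assume xy: "(x, y) \<in> F"
    then have "(x, y) \<in> arcs n" using F(1) by blast
    have lx: "lev (x, y) \<noteq> m" and cx: "col (x, y) \<noteq> j" using xy m j by auto
    from \<open>(x, y) \<in> arcs n\<close> consider
        (ring) i where "i < perimeter n" "x = node n 0 i" "y = node n 0 (Suc i)"
      | (up) l i where "l \<le> n" "i < perimeter n" "x = node n l i" "y = node n (Suc l) (Suc i)"
      | (down) l i where "l \<le> n" "i < perimeter n" "x = node n l (Suc i)" "y = node n (Suc l) i"
      | (top) i where "i < perimeter n" "x = node n (Suc n) i" "y = Apex"
      unfolding arcs_def by auto
    then show "f x \<noteq> f y"
    proof cases
      case ring
      then have "i \<noteq> j" using cx by (simp add: col_def node_def)
      with step[of i] ring show ?thesis by (simp add: f_def node_def)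
    next
      case up
      then have "i \<noteq> j" "l \<noteq> m" using cx lx by (simp_all add: col_def lev_def node_def)
      with step[of i] up show ?thesis by (auto simp: f_def node_def)
    next
      case down
      then have "i \<noteq> j" "l \<noteq> m" using cx lx twostep[of i] by (auto simp: col_def lev_def node_def)
      with step[of i] down show ?thesis by (auto simp: f_def node_def)
    next
      case top
      then show ?thesis using m by (simp add: f_def node_def)
    qed
  qed
qed

text \<open>Order the values of \<open>\<phi>\<close> and count an edge as \<open>1\<close> or \<open>-1\<close> as \<open>\<phi>\<close> rises or falls. Around
  a \<open>4\<close>-cycle with two opposite vertices identified the sum is zero. So the sum along
  the closed walk that zigzags between two levels does not depend on the levels. At the bottom it is
  twice the sum along the cycle, at the top it can be routed through the apex
  and vanishes. But the sum along the cycle has an odd number of odd terms.\<close>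

lemma quadrangle_obstruction:
  assumes adj: "\<And>x y. adjacent n x y \<Longrightarrow> \<phi> x \<noteq> \<phi> y"
    and quad: "\<And>x y z t. adjacent n x y \<Longrightarrow> adjacent n y z \<Longrightarrow> adjacent n z t \<Longrightarrow>
      adjacent n t x \<Longrightarrow> \<phi> x = \<phi> z \<or> \<phi> y = \<phi> t"
  shows False
proof -
  \<comment> \<open>\<open>r\<close> represents the values of \<open>\<phi>\<close>, of which there are countably many, by integers\<close>
  define r where "r x = int (to_nat (inv \<phi> (\<phi> x)))" for x
  have r: "r x = r y \<longleftrightarrow> \<phi> x = \<phi> y" for x y
    unfolding r_def by (metis f_inv_into_f nat_int rangeI to_nat_split)
  define \<omega> where "\<omega> x y = sgn (r y - r x)" for x y
  have anti: "\<omega> y x = - \<omega> x y" for x y by (simp add: \<omega>_def sgn_if)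
  have quad': "\<omega> x y + \<omega> y z = \<omega> x t + \<omega> t z"
    if "adjacent n x y" "adjacent n y z" "adjacent n z t" "adjacent n t x" for x y z t
  proof -
    have "r x = r z \<or> r y = r t" using quad[OF that] r by simp
    then show ?thesis by (auto simp: \<omega>_def sgn_if)
  qed
  have shift: "(\<Sum>i<perimeter n. F (Suc i mod perimeter n)) = (\<Sum>i<perimeter n. F (i mod perimeter n))" for F :: "nat \<Rightarrow> int"
  proof -
    obtain M where M: "perimeter n = Suc M" using perimeter_pos[of n] by (cases "perimeter n") auto
    have "(\<Sum>i<Suc M. F (Suc i mod perimeter n)) = (\<Sum>i<M. F (Suc i mod perimeter n)) + F 0"
      by (simp add: M)
    also have "\<dots> = (\<Sum>i<M. F (Suc i)) + F 0" by (simp add: M)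
    also have "\<dots> = (\<Sum>i<Suc M. F i)" by (simp add: sum.lessThan_Suc_shift del: sum.lessThan_Suc)
    finally show ?thesis by (simp add: M del: sum.lessThan_Suc)
  qed
  let ?P = "node n"
  have shift': "(\<Sum>i<perimeter n. \<omega> (?P l (Suc i)) (?P l' (Suc (Suc i)))) = (\<Sum>i<perimeter n. \<omega> (?P l i) (?P l' (Suc i)))"
    for l l'
    using shift[of "\<lambda>i. \<omega> (?P l i) (?P l' (Suc i))"] by (simp add: node_mod)
  define C where "C = (\<Sum>i<perimeter n. \<omega> (?P 0 i) (?P 0 (Suc i)))"
  define Z where "Z l = (\<Sum>i<perimeter n. \<omega> (?P l i) (?P (Suc l) (Suc i)) + \<omega> (?P (Suc l) (Suc i)) (?P l (Suc (Suc i))))" for l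
  have "Z 0 = (\<Sum>i<perimeter n. \<omega> (?P 0 i) (?P 0 (Suc i)) + \<omega> (?P 0 (Suc i)) (?P 0 (Suc (Suc i))))"
    unfolding Z_def
    by (intro sum.cong refl quad')
      (simp_all add: adjacent_ring adjacent_up adjacent_down adjacent_sym)
  then have Z0: "Z 0 = 2 * C"
    by (simp add: sum.distrib shift' C_def)
  have "Z (Suc l) = Z l" if "Suc l \<le> n" for l
  proof -
    have "Z (Suc l) = (\<Sum>i<perimeter n. \<omega> (?P (Suc l) i) (?P l (Suc i)) + \<omega> (?P l (Suc i)) (?P (Suc l) (Suc (Suc i))))"
      unfolding Z_def using that
      by (intro sum.cong refl quad')
        (simp_all add: adjacent_up adjacent_down adjacent_sym)
    also have "\<dots> = Z l"
      unfolding Z_def sum.distrib shift'[of l "Suc l"] shift'[of "Suc l" l] by simp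
    finally show ?thesis .
  qed
  then have "Z l = Z 0" if "l \<le> n" for l
    using that by (induction l) auto
  moreover have "(\<Sum>i<perimeter n. \<omega> (?P (Suc n) i) (?P n (Suc i)) + \<omega> (?P n (Suc i)) (?P (Suc n) (Suc (Suc i)))) =
    (\<Sum>i<perimeter n. \<omega> (?P (Suc n) i) Apex + \<omega> Apex (?P (Suc n) (Suc (Suc i))))"
    by (intro sum.cong refl quad')
      (simp_all add: adjacent_up adjacent_down adjacent_apex adjacent_sym)
  then have "Z n = (\<Sum>i<perimeter n. \<omega> (?P (Suc n) i) Apex + \<omega> Apex (?P (Suc n) (Suc (Suc i))))"
    unfolding Z_def sum.distrib shift'[of n "Suc n"] shift'[of "Suc n" n] by simp
  also have "\<dots> = (\<Sum>i<perimeter n. \<omega> (?P (Suc n) i) Apex) - (\<Sum>i<perimeter n. \<omega> (?P (Suc n) (Suc (Suc i))) Apex)"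
    by (simp add: anti[of Apex] sum_subtractf)
  also have "\<dots> = 0"
    using shift[of "\<lambda>i. \<omega> (?P (Suc n) i) Apex"] shift[of "\<lambda>i. \<omega> (?P (Suc n) (Suc i)) Apex"]
    by (simp add: node_mod)
  ultimately have "C = 0" using Z0 by simp
  moreover have "odd (\<omega> (?P 0 i) (?P 0 (Suc i)))" for i
    using adj[OF adjacent_ring[of n i]] r by (auto simp: \<omega>_def sgn_if)
  then have "odd C \<longleftrightarrow> odd (perimeter n)"
    unfolding C_def by (induction "perimeter n") (auto simp: even_sum_iff)
  ultimately show False by (simp add: perimeter_def)
qed

definition hyperedge_list :: "nat \<Rightarrow> vert \<times> vert \<Rightarrow> vert list" where
  "hyperedge_list k a = [fst a, snd a, Mid (fst a) (snd a)] @ map Pad [0..<k - 3]"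

definition listings :: "nat \<Rightarrow> nat \<Rightarrow> vert list set" where
  "listings n k = {w. distinct w \<and> (\<exists>a\<in>arcs n. set w = set (hyperedge_list k a))}"

fun graph_vertex :: "vert \<Rightarrow> bool" where
  "graph_vertex (Node l i) = True"
| "graph_vertex Apex = True"
| "graph_vertex _ = False"

text \<open>The two-colouring \<open>f\<close> of the graph, extended to the hyperedges; the optional vertex
  \<open>z\<close> is recoloured with the third colour, the usual colour of the vertices \<open>Mid x y\<close>.\<close>

fun colour :: "nat \<Rightarrow> (vert \<Rightarrow> bool) \<Rightarrow> vert option \<Rightarrow> vert \<Rightarrow> nat" where
  "colour k f z (Mid x y) = (if z = Some x then of_bool (\<not> f y)
     else if z = Some y then of_bool (\<not> f x) else 2)"
| "colour k f z (Pad i) = (if i < k - 3 then i + 3 else 0)"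
| "colour k f z x = (if z = Some x then 2 else of_bool (f x))"

lemma colour_graph_vertex:
  "graph_vertex x \<Longrightarrow> colour k f z x = (if z = Some x then 2 else of_bool (f x))"
  by (cases x) auto

lemma arcs_graph_vertices: "(x, y) \<in> arcs n \<Longrightarrow> graph_vertex x \<and> graph_vertex y \<and> x \<noteq> y"
  by (auto simp: arcs_def node_def mod_Suc perimeter_def split: if_splits)

lemma hyperedge_list_distinct: "a \<in> arcs n \<Longrightarrow> distinct (hyperedge_list k a)"
  using arcs_graph_vertices[of "fst a" "snd a" n]
  by (auto simp: hyperedge_list_def distinct_map inj_on_def)

lemma length_hyperedge_list: "k \<ge> 3 \<Longrightarrow> length (hyperedge_list k a) = k"
  by (simp add: hyperedge_list_def)

lemma hyperedge_list_in_listings: "a \<in> arcs n \<Longrightarrow> hyperedge_list k a \<in> listings n k"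
  by (auto simp: listings_def hyperedge_list_distinct)

lemma listings_length:
  assumes "k \<ge> 3" "w \<in> listings n k"
  shows "length w = k"
proof -
  obtain a where a: "a \<in> arcs n" "distinct w" "set w = set (hyperedge_list k a)"
    using assms(2) by (auto simp: listings_def)
  have "length w = card (set (hyperedge_list k a))"
    using a(2,3) distinct_card[of w] by simp
  also have "\<dots> = k"
    using distinct_card[OF hyperedge_list_distinct[OF a(1), of k]] length_hyperedge_list[OF assms(1)]
    by simp
  finally show ?thesis .
qed

lemma colour_less: "k \<ge> 3 \<Longrightarrow> colour k f z v < k"
  by (cases "(k, f, z, v)" rule: colour.cases) auto

lemma colour_hyperedge:
  assumes "graph_vertex x" "graph_vertex y" "x \<noteq> y" "f x \<noteq> f y"
  shows "distinct (map (colour k f z) (hyperedge_list k (x, y)))"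
proof -
  let ?A = "map (colour k f z) [x, y, Mid x y]" and ?B = "map (\<lambda>i. i + 3) [0..<k - 3]"
  have "map (colour k f z) (hyperedge_list k (x, y)) = ?A @ ?B"
    by (simp add: hyperedge_list_def)
  moreover have "distinct ?A" "set ?A \<subseteq> {..<3}"
    using assms by (auto simp: colour_graph_vertex of_bool_def)
  moreover have "distinct ?B" "set ?B \<subseteq> {3..}"
    by (auto simp: distinct_map)
  moreover have "{..<3} \<inter> {3..} = ({} :: nat set)" by auto
  ultimately show ?thesis
    by (simp only: distinct_append) blast
qed

text \<open>A \<open>k\<close>-set that is not a hyperedge either contains no \<open>Mid x y\<close>, and then at most \<open>k - 1\<close> colours
  occur in it as long as no vertex is recoloured, or it contains some \<open>Mid x y\<close> and a vertex outside the
  hyperedge of \<open>x y\<close>, and these two can be coloured alike. Vertices in no hyperedge can be recoloured freely.\<close>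

lemma few_hyperedges_colourable:
  assumes k: "k \<ge> 3" and D: "D \<subseteq> listings n k" "finite D" "card D \<le> n" and u: "u \<notin> listings n k"
  shows "\<exists>c. range c \<subseteq> {..<k} \<and> (\<forall>w\<in>D. distinct (map c w)) \<and>
    \<not> (length u = k \<and> distinct (map c u))"
proof -
  define arc where "arc w = (SOME a. a \<in> arcs n \<and> set w = set (hyperedge_list k a))" for w
  have arc: "arc w \<in> arcs n \<and> set w = set (hyperedge_list k (arc w))" if "w \<in> D" for w
  proof -
    have "\<exists>a. a \<in> arcs n \<and> set w = set (hyperedge_list k a)"
      using D(1) that unfolding listings_def by blast
    then show ?thesis unfolding arc_def by (rule someI_ex)
  qed
  have "arc ` D \<subseteq> arcs n" using arc by blast
  moreover have "card (arc ` D) \<le> n" using D(3) card_image_le[OF D(2), of arc] by linarith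
  ultimately have "\<exists>f :: vert \<Rightarrow> bool. \<forall>x y. (x, y) \<in> arc ` D \<longrightarrow> f x \<noteq> f y"
    by (rule few_arcs_bipartite)
  then obtain f :: "vert \<Rightarrow> bool" where f: "\<forall>x y. (x, y) \<in> arc ` D \<longrightarrow> f x \<noteq> f y" by blast
  have D_rainbow: "distinct (map (colour k f z) w)" if "w \<in> D" for w z
  proof -
    obtain x y where xy: "arc w = (x, y)" by fastforce
    have "(x, y) \<in> arc ` D" "(x, y) \<in> arcs n"
      using arc[OF that] imageI[OF that, of arc] by (simp_all only: xy)
    then have "distinct (map (colour k f z) (hyperedge_list k (x, y)))"
      using f arcs_graph_vertices by (intro colour_hyperedge) blast+
    then have "inj_on (colour k f z) (set w)"
      using arc[OF that] xy by (simp add: distinct_map)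
    moreover have "distinct w" using D(1) that by (auto simp: listings_def)
    ultimately show ?thesis by (simp add: distinct_map)
  qed
  have clash: "\<exists>c. range c \<subseteq> {..<k} \<and> (\<forall>w\<in>D. distinct (map c w)) \<and> \<not> (length u = k \<and> distinct (map c u))"
    if "v \<in> set u" "v' \<in> set u" "v \<noteq> v'" "colour k f z v = colour k f z v'" for v v' z
  proof (intro exI[of _ "colour k f z"] conjI ballI)
    show "range (colour k f z) \<subseteq> {..<k}" using colour_less[OF k] by blast
    show "distinct (map (colour k f z) w)" if "w \<in> D" for w using D_rainbow[OF that] .
    have "\<not> inj_on (colour k f z) (set u)" using that by (meson inj_onD)
    then show "\<not> (length u = k \<and> distinct (map (colour k f z) u))" by (simp add: distinct_map)
  qed
  define U where "U = (\<Union>a\<in>arcs n. set (hyperedge_list k a))"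
  show ?thesis
  proof (cases "length u = k \<and> distinct u")
    case False
    then show ?thesis
      using D_rainbow[of _ None] colour_less[OF k, of f None]
      by (intro exI[of _ "colour k f None"] conjI ballI) (blast, blast, auto simp: distinct_map)
  next
    case u_k: True
    then have card_u: "card (set u) = k" by (simp add: distinct_card)
    consider (outside) j where "j \<in> set u" "j \<notin> U"
      | (mid) x y where "set u \<subseteq> U" "Mid x y \<in> set u" "(x, y) \<in> arcs n"
      | (no_mid) "set u \<subseteq> U" "\<And>v. v \<in> set u \<Longrightarrow> graph_vertex v \<or> v \<in> Pad ` {..<k - 3}"
    proof (cases "set u \<subseteq> U")
      case sub: True
      show thesis
      proof (cases "\<exists>x y. (x, y) \<in> arcs n \<and> Mid x y \<in> set u")
        case True
        with sub show thesis using mid by blast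
      next
        case False
        have "graph_vertex v \<or> v \<in> Pad ` {..<k - 3}" if vu: "v \<in> set u" for v
        proof -
          obtain a where "a \<in> arcs n" "v \<in> set (hyperedge_list k a)"
            using vu sub unfolding U_def by blast
          with False vu arcs_graph_vertices[of "fst a" "snd a" n] show ?thesis
            by (cases a) (auto simp: hyperedge_list_def)
        qed
        with sub show thesis by (rule no_mid)
      qed
    qed (use outside in blast)
    then show ?thesis
    proof cases
      case outside
      obtain v where v: "v \<in> set u" "v \<noteq> j"
      proof (rule ccontr)
        assume "\<not> thesis"
        then have "set u \<subseteq> {j}" using that by blast
        then have "card (set u) \<le> 1" using card_mono[of "{j}" "set u"] by simp
        with card_u k show False by simp
      qed
      let ?c = "(colour k f None)(j := colour k f None v)"
      have "map ?c w = map (colour k f None) w" if "w \<in> D" for w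
      proof -
        have "j \<notin> set w" using arc[OF that] outside(2) unfolding U_def by blast
        then show ?thesis by simp
      qed
      then have "\<forall>w\<in>D. distinct (map ?c w)" using D_rainbow by metis
      moreover have "\<not> inj_on ?c (set u)"
        using v outside(1) inj_onD[of ?c "set u" v j] by auto
      then have "\<not> (length u = k \<and> distinct (map ?c u))" by (simp only: distinct_map) blast
      moreover have "range ?c \<subseteq> {..<k}"
      proof (rule image_subsetI)
        show "?c v' \<in> {..<k}" for v' using colour_less[OF k, of f None] by simp
      qed
      ultimately show ?thesis by blast
    next
      case mid
      have "\<not> set u \<subseteq> set (hyperedge_list k (x, y))"
      proof
        assume "set u \<subseteq> set (hyperedge_list k (x, y))"
        moreover have "card (set (hyperedge_list k (x, y))) = k"
          using hyperedge_list_distinct[OF mid(3), of k] length_hyperedge_list[OF k]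
          by (simp add: distinct_card)
        ultimately have "set u = set (hyperedge_list k (x, y))"
          using card_u by (intro card_subset_eq) auto
        with u u_k mid(3) show False by (auto simp: listings_def)
      qed
      then obtain v where v: "v \<in> set u" "v \<notin> set (hyperedge_list k (x, y))" by blast
      then obtain a where a: "a \<in> arcs n" "v \<in> set (hyperedge_list k a)"
        using mid(1) v(1) unfolding U_def by blast
      have ne: "Mid x y \<noteq> v" using v(2) by (auto simp: hyperedge_list_def)
      have "graph_vertex v \<or> (\<exists>x y. v = Mid x y)"
        using a(2) v(2) arcs_graph_vertices[of "fst a" "snd a" n] a(1) by (auto simp: hyperedge_list_def)
      then show ?thesis
      proof
        assume "graph_vertex v"
        then have "colour k f (Some v) (Mid x y) = colour k f (Some v) v"
          using v(2) by (simp add: colour_graph_vertex hyperedge_list_def)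
        then show ?thesis by (rule clash[OF mid(2) v(1) ne])
      next
        assume "\<exists>x y. v = Mid x y"
        then have "colour k f None (Mid x y) = colour k f None v" by auto
        then show ?thesis by (rule clash[OF mid(2) v(1) ne])
      qed
    next
      case no_mid
      have "colour k f None ` set u \<subseteq> {..<k} - {2}"
      proof
        fix c assume "c \<in> colour k f None ` set u"
        then obtain v where v: "v \<in> set u" "c = colour k f None v" by blast
        then show "c \<in> {..<k} - {2}"
          using no_mid(2)[OF v(1)] colour_less[OF k, of f None v]
            by (auto simp: colour_graph_vertex of_bool_def split: if_splits)
      qed
      then have "card (colour k f None ` set u) \<le> card ({..<k} - {2})"
        by (intro card_mono) auto
      also have "\<dots> < k" using k by simp
      finally have "\<not> inj_on (colour k f None) (set u)"
        using card_u card_image by force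
      then obtain v v' where "v \<in> set u" "v' \<in> set u" "v \<noteq> v'" "colour k f None v = colour k f None v'"
        unfolding inj_on_def by blast
      then show ?thesis by (rule clash)
    qed
  qed
qed


section \<open>Nonzero products in the hypergraph semiring\<close>

lemma hcong_ctx:
  assumes "hcong V E u u'" "set a \<subseteq> insert Zero (Gen ` V)" "set b \<subseteq> insert Zero (Gen ` V)"
  shows "hcong V E (a @ u @ b) (a @ u' @ b)"
proof -
  have *: "hcong V E (u @ b) (u' @ b)"
  proof (cases "b = []")
    case False
    then have "hcong V E b b" using assms(3) by (intro hcong.refl) (simp add: words_def)
    with assms(1) show ?thesis by (rule hcong.mult)
  qed (simp add: assms(1))
  show ?thesis
  proof (cases "a = []")
    case False
    then have "hcong V E a a" using assms(2) by (intro hcong.refl) (simp add: words_def)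
    then show ?thesis using * by (rule hcong.mult)
  qed (simp add: *)
qed

lemma hcong_zero_ctx:
  assumes "set a \<subseteq> insert Zero (Gen ` V)" "set b \<subseteq> insert Zero (Gen ` V)"
  shows "hcong V E (a @ [Zero] @ b) [Zero]"
proof -
  have "hcong V E ([Zero] @ b) [Zero]"
  proof (cases "b = []")
    case True
    then show ?thesis by (simp add: hcong.refl words_def)
  next
    case False
    with assms(2) show ?thesis by (simp add: hcong.zero_left words_def)
  qed
  with hcong_ctx[OF this assms(1), of "[]"] have "hcong V E (a @ [Zero] @ b) (a @ [Zero])" by simp
  moreover have "hcong V E (a @ [Zero]) [Zero]"
  proof (cases "a = []")
    case True
    then show ?thesis by (simp add: hcong.refl words_def)
  next
    case False
    with assms(1) show ?thesis by (simp add: hcong.zero_right words_def)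
  qed
  ultimately show ?thesis by (rule hcong.trans)
qed

lemma hcong_move:
  assumes "x \<in> V" "set p \<subseteq> V"
  shows "hcong V E (map Gen (p @ [x])) (map Gen (x # p))"
  using assms(2)
proof (induction p)
  case Nil
  show ?case using assms(1) by (auto intro!: hcong.refl simp: words_def)
next
  case (Cons y p)
  have "hcong V E (map Gen ((y # p) @ [x])) (map Gen (y # x # p))"
    using hcong_ctx[of V E _ _ "[Gen y]" "[]"] Cons by auto
  moreover have "hcong V E (map Gen (y # x # p)) (map Gen (x # y # p))"
    using hcong_ctx[OF hcong.comm[of y V x E], of "[]" "map Gen p"] Cons.prems assms(1) by auto
  ultimately show ?case by (rule hcong.trans)
qed

lemma hcong_perm:
  assumes "mset xs = mset ys" "set xs \<subseteq> V" "xs \<noteq> []"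
  shows "hcong V E (map Gen xs) (map Gen ys)"
  using assms
proof (induction xs arbitrary: ys)
  case (Cons x xs)
  have "x \<in> set ys" using mset_eq_setD[OF Cons.prems(1)] by auto
  then obtain p q where ys: "ys = p @ x # q" by (meson split_list)
  have m: "mset xs = mset (p @ q)" using Cons.prems(1) ys by simp
  have V: "x \<in> V" "set p \<subseteq> V" "set q \<subseteq> V"
    using Cons.prems(2) mset_eq_setD[OF Cons.prems(1)] ys by auto
  have "hcong V E (map Gen (x # xs)) (map Gen (x # p @ q))"
  proof (cases "xs = []")
    case True
    with m V show ?thesis by (auto intro!: hcong.refl simp: words_def)
  next
    case False
    with Cons.IH[OF m] Cons.prems(2) have "hcong V E (map Gen xs) (map Gen (p @ q))" by simp
    from hcong_ctx[OF this, of "[Gen x]" "[]"] V show ?thesis by simp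
  qed
  moreover have "hcong V E (map Gen (x # p @ q)) (map Gen (p @ x # q))"
    using hcong_ctx[OF hcong.sym[OF hcong_move[OF V(1,2), of E]], of "[]" "map Gen q"] V by auto
  ultimately show ?case unfolding ys by (rule hcong.trans)
qed simp

locale girth_gt_4_hypergraph =
  fixes V :: "'v set" and E :: "'v set set" and k :: nat
  assumes k: "k \<ge> 3"
    and hyp: "hypergraph V E"
    and unif: "uniform k E"
    and no_isolated: "\<forall>v\<in>V. \<not> isolated E v"
    and girth: "girth V E > 4"
begin

lemma edge_card: "e \<in> E \<Longrightarrow> finite e \<and> card e = k"
  using unif by (simp add: uniform_def)

lemma edge_subset: "e \<in> E \<Longrightarrow> e \<subseteq> V"
  using hyp by (simp add: hypergraph_def)

lemma no_short_cycle:
  assumes "n \<le> 4"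
  shows "\<not> is_cycle V E n v e"
proof
  assume "is_cycle V E n v e"
  then have "girth V E \<le> enat n"
    unfolding girth_def by (intro Inf_lower) blast
  also have "\<dots> \<le> 4" using assms by (simp add: numeral_eq_enat)
  finally show False using girth by simp
qed

lemma linear:
  assumes "e \<in> E" "e' \<in> E" "x \<noteq> y" "{x, y} \<subseteq> e" "{x, y} \<subseteq> e'"
  shows "e = e'"
proof (rule ccontr)
  assume "e \<noteq> e'"
  then have "is_cycle V E 2 (\<lambda>i. if i = 1 then y else x) (\<lambda>i. if i = 1 then e else e')"
    using assms edge_subset[OF assms(1)]
    by (auto simp: is_cycle_def inj_on_def numeral_2_eq_2 atLeastAtMostSuc_conv atLeastLessThanSuc)
  with no_short_cycle show False by fastforce
qed

lemma triangle:
  assumes "e1 \<in> E" "e2 \<in> E" "e3 \<in> E" "distinct [x, y, z]"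
    "{x, y} \<subseteq> e1" "{y, z} \<subseteq> e2" "{z, x} \<subseteq> e3"
  shows "z \<in> e1"
proof (rule ccontr)
  assume z: "z \<notin> e1"
  then have d: "e1 \<noteq> e2" "e1 \<noteq> e3" using assms by auto
  have "e2 \<noteq> e3" using linear[of e1 e2 x y] assms d by auto
  with d have "is_cycle V E 3 (\<lambda>i. [x, y, z, x] ! i) (\<lambda>i. [e1, e1, e2, e3] ! i)"
    using assms edge_subset[OF assms(1)] edge_subset[OF assms(2)]
    by (auto simp: is_cycle_def inj_on_def numeral_3_eq_3 atLeastAtMostSuc_conv atLeastLessThanSuc)
  with no_short_cycle show False by fastforce
qed

text \<open>As there is no cycle of length \<open>4\<close>, two of the hyperedges coincide; the triangle formed with the
  remaining two then puts the fourth vertex into the repeated one.\<close>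

lemma quadrangle:
  assumes "e1 \<in> E" "e2 \<in> E" "e3 \<in> E" "e4 \<in> E" "distinct [x, y, z, t]"
    "{x, y} \<subseteq> e1" "{y, z} \<subseteq> e2" "{z, t} \<subseteq> e3" "{t, x} \<subseteq> e4"
  shows "{z, t} \<subseteq> e1"
proof -
  have "\<not> distinct [e1, e2, e3, e4]"
  proof
    assume "distinct [e1, e2, e3, e4]"
    then have "is_cycle V E 4 (\<lambda>i. [x, y, z, t, x] ! i) (\<lambda>i. [e1, e1, e2, e3, e4] ! i)"
      using assms edge_subset[OF assms(1)] edge_subset[OF assms(3)]
      by (auto simp: is_cycle_def inj_on_def eval_nat_numeral atLeastAtMostSuc_conv
          atLeastLessThanSuc)
    with no_short_cycle show False by fastforce
  qed
  then consider "e1 = e2" | "e1 = e3" | "e1 = e4" | "e2 = e3" | "e2 = e4" | "e3 = e4"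
    by auto
  then have "\<exists>e\<in>E. {x, y, z, t} \<subseteq> e"
  proof cases
    case 1
    have "t \<in> e1" using triangle[of e1 e3 e4 x z t] assms 1 by auto
    with 1 assms show ?thesis by auto
  next
    case 3
    have "z \<in> e1" using triangle[of e1 e2 e3 t y z] assms 3 by auto
    with 3 assms show ?thesis by auto
  next
    case 4
    have "x \<in> e2" using triangle[of e2 e4 e1 y t x] assms 4 by auto
    with 4 assms show ?thesis by auto
  next
    case 6
    have "y \<in> e3" using triangle[of e3 e1 e2 z x y] assms 6 by auto
    with 6 assms show ?thesis by auto
  qed (use assms in auto)
  then obtain e where e: "e \<in> E" "{x, y, z, t} \<subseteq> e" by blast
  with linear[of e1 e x y] assms have "e1 = e" by auto
  with e show ?thesis by auto
qed

text \<open>Since multiplication commutes, any two letters of a nonzero word lie in a common hyperedge;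
  as triangles stay in one hyperedge, so does the whole word.\<close>

lemma nonzero_word:
  assumes w: "w \<in> words V" "\<not> hcong V E w [Zero]"
  obtains vs where "w = map Gen vs" "distinct vs" "\<exists>e\<in>E. set vs \<subseteq> e"
proof -
  have "Zero \<notin> set w"
  proof
    assume "Zero \<in> set w"
    then obtain a b where "w = a @ Zero # b" by (meson split_list)
    with hcong_zero_ctx[of a V b E] w show False by (auto simp: words_def)
  qed
  with w(1) have "set w \<subseteq> Gen ` V" by (auto simp: words_def)
  then obtain vs where vs: "w = map Gen vs"
    by (metis ex_map_conv image_iff subsetD)
  with w(1) have V: "set vs \<subseteq> V" and ne: "vs \<noteq> []" by (auto simp: words_def)
  have pair: "x \<noteq> y \<and> subhyperedge V E {x, y}" if "mset vs = mset (x # y # r)" for x y r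
  proof (rule ccontr)
    assume "\<not> (x \<noteq> y \<and> subhyperedge V E {x, y})"
    moreover have r: "x \<in> V" "y \<in> V" "set r \<subseteq> V"
      using V mset_eq_setD[OF that] by auto
    ultimately have "hcong V E [Gen x, Gen y] [Zero]"
      by (intro hcong.null) auto
    from hcong_ctx[OF this, of "[]" "map Gen r"] r(3)
    have "hcong V E (map Gen (x # y # r)) ([Zero] @ map Gen r)" by auto
    moreover have "hcong V E ([Zero] @ map Gen r) [Zero]"
      using hcong_zero_ctx[of "[]" V "map Gen r" E] r(3) by auto
    moreover note hcong_perm[OF that V ne]
    ultimately show False using w(2) vs by (blast intro: hcong.trans)
  qed
  have dist: "distinct vs"
  proof (rule ccontr)
    assume "\<not> distinct vs"
    then obtain p x q r where "vs = p @ [x] @ q @ [x] @ r"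
      using not_distinct_decomp by blast
    with pair[of x x "p @ q @ r"] show False by simp
  qed
  have adj: "\<exists>e\<in>E. {x, y} \<subseteq> e" if xy: "x \<in> set vs" "y \<in> set vs" "x \<noteq> y" for x y
  proof -
    have rm: "mset l = mset (z # remove1 z l)" if "z \<in> set l" for z and l :: "'v list"
      using that by (simp only: mset.simps mset_remove1 set_mset_mset insert_DiffM)
    have "y \<in> set (remove1 x vs)" using xy by (simp add: in_set_remove1)
    then have "mset vs = mset (x # y # remove1 y (remove1 x vs))"
      using rm[of x vs] rm[of y "remove1 x vs"] xy(1) by (simp only: mset.simps)
    from pair[OF this] show ?thesis by (auto simp: subhyperedge_def)
  qed
  obtain x where x: "x \<in> set vs" using ne by (meson last_in_set)
  have "\<exists>e\<in>E. set vs \<subseteq> e"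
  proof (cases "set vs = {x}")
    case True
    then show ?thesis using no_isolated V by (auto simp: isolated_def)
  next
    case False
    then obtain y where y: "y \<in> set vs" "x \<noteq> y" using x by auto
    then obtain e where e: "e \<in> E" "{x, y} \<subseteq> e" using adj x by blast
    have "z \<in> e" if zs: "z \<in> set vs" for z
    proof (cases "z = x \<or> z = y")
      case True
      with e show ?thesis by auto
    next
      case False
      then obtain e2 e3 where "e2 \<in> E" "{y, z} \<subseteq> e2" "e3 \<in> E" "{z, x} \<subseteq> e3"
        using adj[OF y(1) zs] adj[OF zs x] by auto
      with triangle[of e e2 e3 x y z] False y e show ?thesis by auto
    qed
    with e show ?thesis by blast
  qed
  with that vs dist show thesis by blast
qed

definition lists_edge :: "'v gen list \<Rightarrow> bool" where
  "lists_edge w \<longleftrightarrow> (\<exists>vs. w = map Gen vs \<and> distinct vs \<and> set vs \<in> E)"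

lemma lists_edge_Gen: "lists_edge (map Gen vs) \<longleftrightarrow> distinct vs \<and> set vs \<in> E"
proof -
  have "map Gen vs = map Gen vs' \<longleftrightarrow> vs = vs'" for vs' :: "'v list"
    by (rule inj_map_eq_map) (simp add: inj_def)
  then show ?thesis by (auto simp: lists_edge_def)
qed

lemma lists_edge_Zero: "Zero \<in> set w \<Longrightarrow> \<not> lists_edge w"
  by (auto simp: lists_edge_def)

lemma lists_edge_mset:
  assumes "mset w = mset w'" "lists_edge w"
  shows "lists_edge w'"
proof -
  obtain vs where vs: "w = map Gen vs" "distinct vs" "set vs \<in> E"
    using assms(2) by (auto simp: lists_edge_def)
  have "set w' \<subseteq> range Gen" using mset_eq_setD[OF assms(1)] vs by auto
  then obtain vs' where vs': "w' = map Gen vs'" by (metis ex_map_conv image_iff subsetD)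
  have "mset vs = mset vs'"
    using assms(1) unfolding vs vs' mset_map by (rule multiset.inj_map_strong[rotated]) simp
  then have "distinct vs'" "set vs' = set vs"
    using vs(2) mset_eq_imp_distinct_iff[of vs vs'] mset_eq_setD[of vs vs'] by simp_all
  with vs vs' show ?thesis by (auto simp: lists_edge_def)
qed

text \<open>An invariant that keeps such words from collapsing to \<open>0\<close>. For the relation \<open>link\<close> it depends on
  two vertices lying in at most one hyperedge: the word \<open>us\<close> is completed by \<open>w\<close> only.\<close>

lemma hcong_lists_edge:
  "hcong V E w w' \<Longrightarrow> lists_edge (a @ w @ b) \<longleftrightarrow> lists_edge (a @ w' @ b)"
proof (induction arbitrary: a b rule: hcong.induct)
  case (mult u u' w w')
  show ?case
    using mult.IH(1)[of a "w @ b"] mult.IH(2)[of "a @ u'" b] by simp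
next
  case (zero_left w)
  then show ?case by (simp add: lists_edge_Zero)
next
  case (zero_right w)
  then show ?case by (simp add: lists_edge_Zero)
next
  case (comm u v)
  show ?case by (intro iffI; erule lists_edge_mset[rotated]; simp)
next
  case (null u v)
  have "\<not> lists_edge (a @ [Gen u, Gen v] @ b)"
  proof
    assume "lists_edge (a @ [Gen u, Gen v] @ b)"
    then obtain vs where vs: "a @ [Gen u, Gen v] @ b = map Gen vs" "distinct vs" "set vs \<in> E"
      by (auto simp: lists_edge_def)
    then obtain p q where "vs = p @ [u, v] @ q"
      by (auto simp: append_eq_map_conv Cons_eq_map_conv)
    with vs null show False by (auto simp: subhyperedge_def)
  qed
  then show ?case by (simp add: lists_edge_Zero)
next
  case (edge us vs)
  have *: "lists_edge (a @ map Gen xs @ b) \<longleftrightarrow> a = [] \<and> b = []"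
    if xs: "distinct xs" "set xs \<in> E" for xs
  proof
    assume "lists_edge (a @ map Gen xs @ b)"
    then obtain zs where zs: "a @ map Gen xs @ b = map Gen zs" "distinct zs" "set zs \<in> E"
      by (auto simp: lists_edge_def)
    then have "length (a @ map Gen xs @ b) = k"
      using edge_card distinct_card by (metis length_map)
    moreover have "length xs = k" using xs edge_card distinct_card by metis
    ultimately show "a = [] \<and> b = []" by simp
  qed (use xs lists_edge_Gen in auto)
  show ?case using edge by (simp add: *)
next
  case (link w us vs)
  have *: "lists_edge (a @ map Gen ys @ b)"
    if xs: "distinct (xs @ [w])" "set (xs @ [w]) \<in> E"
      and ys: "distinct (ys @ [w])" "set (ys @ [w]) \<in> E"
      and l: "lists_edge (a @ map Gen xs @ b)" for xs ys
  proof -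
    obtain zs where zs: "a @ map Gen xs @ b = map Gen zs" "distinct zs" "set zs \<in> E"
      using l by (auto simp: lists_edge_def)
    from zs(1) obtain p xs' q
      where "zs = p @ xs' @ q" "a = map Gen p" "map Gen xs = map Gen xs'" "b = map Gen q"
      unfolding append_eq_map_conv by blast
    moreover have "inj (Gen :: 'v \<Rightarrow> 'v gen)" by (simp add: inj_def)
    ultimately have pq: "a = map Gen p" "b = map Gen q" "zs = p @ xs @ q"
      by (simp_all add: inj_map_eq_map)
    have "length (p @ xs @ q) = k" using zs pq edge_card distinct_card by metis
    moreover have len: "length (xs @ [w]) = k" using xs edge_card distinct_card by metis
    ultimately have "length (p @ q) = 1" by simp
    then obtain x where x: "p @ q = [x]" by (metis One_nat_def length_0_conv length_Suc_conv)
    from len k obtain u v r where r: "xs = u # v # r"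
      by (cases xs; cases "tl xs") auto
    have "set zs = insert x (set xs)"
      using x pq(3) by (cases p) auto
    with linear[of "set (xs @ [w])" "set zs" u v] xs zs(3) r
    have "insert w (set xs) = insert x (set xs)" by auto
    moreover have "w \<notin> set xs" "x \<notin> set xs"
      using xs zs(2) pq(3) x by (cases p, auto)+
    ultimately have "w = x" by auto
    have "mset (p @ ys @ q) = mset (ys @ [w])"
      using x \<open>w = x\<close> by (cases p) auto
    then have "distinct (p @ ys @ q)" "set (p @ ys @ q) \<in> E"
      using ys mset_eq_imp_distinct_iff[of "p @ ys @ q" "ys @ [w]"]
        mset_eq_setD[of "p @ ys @ q" "ys @ [w]"] by simp_all
    then show ?thesis using lists_edge_Gen[of "p @ ys @ q"] pq by simp
  qed
  show ?case
    using *[of us vs] *[of vs us] link by blast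
qed auto

end

section \<open>Evaluating terms in the hypergraph semiring\<close>

lemma expand_letters:
  assumes "\<And>x. G x \<noteq> [] \<and> set (G x) \<subseteq> A" and "w \<in> expand G t"
  shows "w \<noteq> [] \<and> set w \<subseteq> A"
  using assms(2)
proof (induction t arbitrary: w)
  case (Var x)
  then show ?case using assms(1) by simp
next
  case (Add s t)
  then show ?case by auto
next
  case (Mul s t)
  from Mul.prems obtain u v where uv: "u \<in> expand G s" "v \<in> expand G t" "w = u @ v" by auto
  from Mul.IH(1)[OF uv(1)] Mul.IH(2)[OF uv(2)] uv(3) show ?case by simp
qed

context girth_gt_4_hypergraph
begin

abbreviation S :: "'v gen list set alg" where "S \<equiv> hypergraph_semiring V E"

abbreviation cls :: "'v gen list \<Rightarrow> 'v gen list set" where "cls w \<equiv> hrel V E `` {w}"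

lemma equiv: "equiv (words V) (hrel V E)"
  using equiv_hrel[OF hyp unif] k by simp

lemma algebra_S: "algebra S"
  using algebra_hypergraph_semiring[OF hyp unif] k by simp

lemma hcong_in_words: "hcong V E w w' \<Longrightarrow> w \<in> words V \<and> w' \<in> words V"
  using hcong_words[OF hyp unif] k by simp

lemma cls_eq: "w \<in> words V \<Longrightarrow> w' \<in> words V \<Longrightarrow> cls w = cls w' \<longleftrightarrow> hcong V E w w'"
  using eq_equiv_class_iff[OF equiv, of w w'] by (simp add: hrel_def)

lemma Zero_word: "[Zero] \<in> words V"
  by (simp add: words_def)

lemma carrier_S: "carrier S = cls ` words V"
  by (auto simp: hypergraph_semiring_def quotient_def)

lemma add_S: "add S X Y = (if X = Y then X else cls [Zero])"
  by (simp add: hypergraph_semiring_def)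

lemma mul_S: "u \<in> words V \<Longrightarrow> w \<in> words V \<Longrightarrow> mul S (cls u) (cls w) = cls (u @ w)"
  using mul_class[OF hyp unif] k by simp

lemma expand_in_words: "(\<And>x. G x \<in> words V) \<Longrightarrow> w \<in> expand G t \<Longrightarrow> w \<in> words V"
  unfolding words_def using expand_letters[of G "insert Zero (Gen ` V)" w t] by blast

lemma hcong_Zero_append:
  assumes "u \<in> words V" "w \<in> words V" "hcong V E u [Zero] \<or> hcong V E w [Zero]"
  shows "hcong V E (u @ w) [Zero]"
  using assms(3)
proof
  assume "hcong V E u [Zero]"
  then have "hcong V E (u @ w) ([Zero] @ w)" using hcong.refl[OF assms(2)] by (rule hcong.mult)
  moreover have "hcong V E ([Zero] @ w) [Zero]" using hcong.zero_left[OF assms(2)] by simp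
  ultimately show ?thesis by (rule hcong.trans)
next
  assume "hcong V E w [Zero]"
  with hcong.refl[OF assms(1)] have "hcong V E (u @ w) (u @ [Zero])" by (rule hcong.mult)
  moreover have "hcong V E (u @ [Zero]) [Zero]" using hcong.zero_right[OF assms(1)] by simp
  ultimately show ?thesis by (rule hcong.trans)
qed

text \<open>The semiring is flat and \<open>0\<close> absorbs products, so a nonzero value is
  the common value of all words.\<close>

lemma eval_nonzero:
  assumes G: "\<And>x. G x \<in> words V"
  shows "eval S (\<lambda>x. cls (G x)) t = cls w0 \<Longrightarrow> w0 \<in> words V \<Longrightarrow> \<not> hcong V E w0 [Zero] \<Longrightarrow>
    w \<in> expand G t \<Longrightarrow> hcong V E w w0"
proof (induction t arbitrary: w0 w)
  case (Var x)
  then show ?case using G cls_eq by simp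
next
  case (Add s t)
  have "cls w0 \<noteq> cls [Zero]" using Add.prems(2,3) cls_eq Zero_word by blast
  with Add.prems(1) have "eval S (\<lambda>x. cls (G x)) s = cls w0" "eval S (\<lambda>x. cls (G x)) t = cls w0"
    by (auto simp: add_S split: if_splits)
  with Add show ?case by auto
next
  case (Mul s t)
  have car: "eval S (\<lambda>x. cls (G x)) t \<in> cls ` words V" for t
    using eval_in_carrier[OF algebra_S, of "\<lambda>x. cls (G x)" t] G carrier_S by blast
  obtain ws wt where s: "ws \<in> words V" "eval S (\<lambda>x. cls (G x)) s = cls ws"
    and t: "wt \<in> words V" "eval S (\<lambda>x. cls (G x)) t = cls wt"
    using car[of s] car[of t] by blast
  then have "cls (ws @ wt) = cls w0" using Mul.prems(1) mul_S by simp
  then have c: "hcong V E (ws @ wt) w0"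
    using cls_eq Mul.prems(2) words_append[OF s(1) t(1)] by blast
  have nz: "\<not> hcong V E ws [Zero]" "\<not> hcong V E wt [Zero]"
    using hcong_Zero_append[OF s(1) t(1)] c Mul.prems(3) by (blast intro: hcong.sym hcong.trans)+
  obtain u v where uv: "u \<in> expand G s" "v \<in> expand G t" "w = u @ v"
    using Mul.prems(4) by auto
  have "hcong V E u ws" using Mul.IH(1)[OF s(2,1) nz(1) uv(1)] .
  moreover have "hcong V E v wt" using Mul.IH(2)[OF t(2,1) nz(2) uv(2)] .
  ultimately have "hcong V E (u @ v) (ws @ wt)" by (rule hcong.mult)
  then show ?case using c uv(3) by (blast intro: hcong.trans)
qed

text \<open>An instance of \<open>0\<close>-cancellativity: inside one hyperedge, a complement determines
  the letters of a word.\<close>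

lemma lists_edge_cancel:
  assumes "set (a @ u @ b) \<subseteq> Gen ` e" "set (a @ u' @ b) \<subseteq> Gen ` e" "e \<in> E"
    "lists_edge (a @ u @ b)" "lists_edge (a @ u' @ b)" "u \<noteq> []"
  shows "hcong V E u u'"
proof -
  have listing: "distinct w \<and> set w = Gen ` e" if sub: "set w \<subseteq> Gen ` e" and le: "lists_edge w" for w
  proof -
    obtain vs where vs: "w = map Gen vs" "distinct vs" "set vs \<in> E"
      using le by (auto simp: lists_edge_def)
    have "set vs \<subseteq> e" using sub vs(1) by auto
    then have "set vs = e"
      using edge_card[OF assms(3)] edge_card[OF vs(3)] by (intro card_subset_eq) auto
    then show ?thesis using vs by (auto simp: distinct_map inj_on_def)
  qed
  have "mset (a @ u @ b) = mset (a @ u' @ b)"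
    using listing[OF assms(1,4)] listing[OF assms(2,5)] set_eq_iff_mset_eq_distinct by metis
  then have m: "mset u = mset u'" by simp
  have "set u \<subseteq> range Gen" "set u' \<subseteq> range Gen" using assms(1,2) by auto
  then obtain us us' where us: "u = map Gen us" "u' = map Gen us'"
    by (metis ex_map_conv image_iff subsetD)
  have "mset us = mset us'"
    using m unfolding us mset_map by (rule multiset.inj_map_strong[rotated]) simp
  moreover have "set us \<subseteq> V"
    using assms(1) us(1) edge_subset[OF assms(3)] by auto
  ultimately show ?thesis
    using hcong_perm[of us us' V E] assms(6) us by simp
qed

text \<open>The context is needed for the induction: the other factor of a product becomes part of it.\<close>

lemma eval_edge_listings:
  assumes e: "e \<in> E" and G: "\<And>x. G x \<noteq> []" "\<And>x. set (G x) \<subseteq> Gen ` e"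
  shows "set a \<subseteq> Gen ` e \<Longrightarrow> set b \<subseteq> Gen ` e \<Longrightarrow> \<forall>w\<in>expand G t. lists_edge (a @ w @ b) \<Longrightarrow>
    w0 \<in> expand G t \<Longrightarrow> eval S (\<lambda>x. cls (G x)) t = cls w0"
proof (induction t arbitrary: a b w0)
  case (Var x)
  then show ?case by simp
next
  case (Add s t)
  have wd: "w \<noteq> [] \<and> set w \<subseteq> Gen ` e" if "w \<in> expand G t" for w t
    using expand_letters[OF _ that, of "Gen ` e"] G by blast
  obtain u v where uv: "u \<in> expand G s" "v \<in> expand G t"
    using expand_nonempty[of G s] expand_nonempty[of G t] by blast
  have eq: "cls u' = cls v'" if "u' \<in> expand G (Add s t)" "v' \<in> expand G (Add s t)" for u' v'
  proof -
    have "hcong V E u' v'"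
      using that wd[OF that(1)] wd[OF that(2)] Add.prems
      by (intro lists_edge_cancel[of a u' b e v'] e) auto
    then show ?thesis using cls_eq hcong_in_words by blast
  qed
  have "eval S (\<lambda>x. cls (G x)) s = cls u" using Add.IH(1)[of a b u] Add.prems uv by simp
  moreover have "eval S (\<lambda>x. cls (G x)) t = cls v" using Add.IH(2)[of a b v] Add.prems uv by simp
  ultimately show ?case using eq[of u v] eq[of w0 u] Add.prems(4) uv by (simp add: add_S)
next
  case (Mul s t)
  have wd: "w \<noteq> [] \<and> set w \<subseteq> Gen ` e" if "w \<in> expand G t" for w t
    using expand_letters[OF _ that, of "Gen ` e"] G by blast
  then have wV: "w \<in> words V" if "w \<in> expand G t" for w t
    using that edge_subset[OF e] by (fastforce simp: words_def)
  obtain u v where uv: "u \<in> expand G s" "v \<in> expand G t" "w0 = u @ v"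
    using Mul.prems(4) by auto
  have "eval S (\<lambda>x. cls (G x)) s = cls u"
    using Mul.prems uv wd[OF uv(2)] by (intro Mul.IH(1)[of a "v @ b"]) auto
  moreover have "eval S (\<lambda>x. cls (G x)) t = cls v"
    using Mul.prems uv wd[OF uv(1)] by (intro Mul.IH(2)[of "a @ u" b]) auto
  ultimately show ?case using mul_S[OF wV[OF uv(1)] wV[OF uv(2)]] uv(3) by simp
qed

lemma identity_transfer:
  assumes pq: "(p, q) \<in> identities_of S" and e: "e \<in> E"
    and G: "\<And>x. G x \<noteq> []" "\<And>x. set (G x) \<subseteq> Gen ` e" "set a \<subseteq> Gen ` e" "set b \<subseteq> Gen ` e"
    and p: "\<forall>w\<in>expand G p. lists_edge (a @ w @ b)" and w: "w \<in> expand G q"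
  shows "lists_edge (a @ w @ b)"
proof -
  obtain w0 where w0: "w0 \<in> expand G p" using expand_nonempty by blast
  have GV: "G x \<in> words V" for x
    using G(1,2) edge_subset[OF e] by (fastforce simp: words_def)
  then have "range (\<lambda>x. cls (G x)) \<subseteq> carrier S" by (auto simp: carrier_S)
  with pq have "eval S (\<lambda>x. cls (G x)) q = eval S (\<lambda>x. cls (G x)) p"
    by (simp add: identities_of_def satisfies_def)
  also have "\<dots> = cls w0"
    using eval_edge_listings[OF e G p w0] .
  finally have "eval S (\<lambda>x. cls (G x)) q = cls w0" .
  moreover have "lists_edge (a @ w0 @ b)" using p w0 by blast
  moreover have "\<not> lists_edge (a @ [Zero] @ b)" by (simp add: lists_edge_Zero)
  ultimately have "hcong V E w w0"
    using w GV expand_in_words[OF GV w0] hcong_lists_edge[of w0 "[Zero]" a b]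
    by (intro eval_nonzero[of G q]) auto
  with \<open>lists_edge (a @ w0 @ b)\<close> show ?thesis
    using hcong_lists_edge[of w w0 a b] by simp
qed

end
section \<open>Locally colourable listings respect the identities\<close>

lemma expand_singletons_nonempty: "w \<in> expand (\<lambda>x. [d x]) t \<Longrightarrow> w \<noteq> []"
  using expand_letters[of "\<lambda>x. [d x]" UNIV w t] by simp

context girth_gt_4_hypergraph
begin

text \<open>Applied to \<open>p \<approx> q\<close> and to \<open>q \<approx> p\<close>, this shows that the congruence of \<open>L\<close> contains
  all instances of \<open>p \<approx> q\<close>.\<close>

lemma listing_context_transfer:
  fixes L :: "'b list set" and d :: "nat \<Rightarrow> 'b"
  assumes pq: "(p, q) \<in> identities_of S" and "E \<noteq> {}"
    and L: "\<And>w. w \<in> L \<Longrightarrow> distinct w \<and> length w = k"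
    and colouring: "\<And>D u. D \<subseteq> L \<Longrightarrow> finite D \<Longrightarrow> card D \<le> card (expand (\<lambda>x. [x]) p) \<Longrightarrow> u \<notin> L \<Longrightarrow>
      \<exists>c. range c \<subseteq> {..<k} \<and> (\<forall>w\<in>D. distinct (map c w)) \<and> \<not> (length u = k \<and> distinct (map c u))"
    and p: "\<forall>w\<in>expand (\<lambda>x. [d x]) (subst \<theta> p). a @ w @ b \<in> L"
    and w: "w \<in> expand (\<lambda>x. [d x]) (subst \<theta> q)"
  shows "a @ w @ b \<in> L"
proof (rule ccontr)
  assume notL: "a @ w @ b \<notin> L"
  let ?W = "expand (\<lambda>x. [d x])"
  \<comment> \<open>one word per variable suffices: a word of \<open>q\<close> that repeats a variable gives a word with
    repeated letters, which is not in \<open>L\<close> for any choice\<close>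
  have "\<exists>v g. v \<in> expand (\<lambda>x. [x]) q \<and> (\<forall>x. g x \<in> ?W (\<theta> x)) \<and> a @ concat (map g v) @ b \<notin> L"
  proof -
    obtain v ws where v: "v \<in> expand (\<lambda>x. [x]) q" "list_all2 (\<lambda>x u. u \<in> ?W (\<theta> x)) v ws" "w = concat ws"
      using expand_subst_cases[OF w] by blast
    have ex: "\<exists>u. u \<in> ?W (\<theta> x)" for x using expand_nonempty by blast
    show ?thesis
    proof (cases "distinct v")
      case True
      from distinct_choice[OF this v(2) ex] obtain g where "\<forall>x. g x \<in> ?W (\<theta> x)" "map g v = ws"
        by blast
      with v notL show ?thesis by blast
    next
      case False
      obtain g where g: "\<forall>x. g x \<in> ?W (\<theta> x)" using ex by metis
      obtain p1 x p2 p3 where "v = p1 @ [x] @ p2 @ [x] @ p3"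
        using False not_distinct_decomp by blast
      moreover have "g x \<noteq> []" using g expand_singletons_nonempty by blast
      ultimately have "\<not> distinct (a @ concat (map g v) @ b)" by (cases "g x") auto
      with v(1) g L show ?thesis by blast
    qed
  qed
  then obtain v g where v: "v \<in> expand (\<lambda>x. [x]) q" and g: "\<And>x. g x \<in> ?W (\<theta> x)"
    and bad: "a @ concat (map g v) @ b \<notin> L" by blast
  define D where "D = (\<lambda>s. a @ concat (map g s) @ b) ` expand (\<lambda>x. [x]) p"
  have "card D \<le> card (expand (\<lambda>x. [x]) p)" "finite D"
    unfolding D_def by (auto intro: card_image_le finite_expand)
  moreover have "D \<subseteq> L"
    using p expand_subst_mono[of g "\<lambda>x. [d x]" \<theta> p] g expand_concat[of g p] by (auto simp: D_def)
  ultimately obtain c where c: "range c \<subseteq> {..<k}" "\<forall>w\<in>D. distinct (map c w)"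
    and nc: "\<not> (length (a @ concat (map g v) @ b) = k \<and> distinct (map c (a @ concat (map g v) @ b)))"
    using colouring[OF _ _ _ bad] by blast
  obtain e where e: "e \<in> E" using \<open>E \<noteq> {}\<close> by blast
  obtain \<beta> where \<beta>: "bij_betw \<beta> {..<k} e"
    using edge_card[OF e] by (metis ex_bij_betw_nat_finite lessThan_atLeast0)
  let ?c = "Gen \<circ> \<beta> \<circ> c"
  have ce: "set (map ?c xs) \<subseteq> Gen ` e" for xs
    using c(1) bij_betw_imp_surj_on[OF \<beta>] by fastforce
  have exG: "expand (\<lambda>x. map ?c (g x)) t = (\<lambda>s. map ?c (concat (map g s))) ` expand (\<lambda>x. [x]) t" for t
    by (subst expand_map, subst expand_concat) (simp add: image_image)
  have rainbow: "lists_edge (map ?c xs) \<longleftrightarrow> length xs = k \<and> distinct (map c xs)" for xs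
  proof -
    have inj: "inj_on \<beta> (set (map c xs))"
      using c(1) by (intro inj_on_subset[OF bij_betw_imp_inj_on[OF \<beta>]]) auto
    have d: "distinct (map \<beta> (map c xs)) \<longleftrightarrow> distinct (map c xs)"
      using inj by (subst distinct_map) blast
    have l: "lists_edge (map ?c xs) \<longleftrightarrow> distinct (map \<beta> (map c xs)) \<and> set (map \<beta> (map c xs)) \<in> E"
      using lists_edge_Gen[of "map \<beta> (map c xs)"] by (simp add: comp_assoc)
    show ?thesis
    proof
      assume "lists_edge (map ?c xs)"
      then have "distinct (map \<beta> (map c xs))" "set (map \<beta> (map c xs)) \<in> E" using l by auto
      then show "length xs = k \<and> distinct (map c xs)"
        using d edge_card distinct_card by (metis length_map)
    next
      assume xs: "length xs = k \<and> distinct (map c xs)"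
      then have "card (set (map \<beta> (map c xs))) = k" using d distinct_card by (metis length_map)
      moreover have "set (map \<beta> (map c xs)) \<subseteq> e"
        using c(1) bij_betw_imp_surj_on[OF \<beta>] by fastforce
      ultimately have "set (map \<beta> (map c xs)) = e"
        using edge_card[OF e] by (intro card_subset_eq) auto
      then show "lists_edge (map ?c xs)" using l d xs e by auto
    qed
  qed
  have "lists_edge (map ?c a @ map ?c (concat (map g v)) @ map ?c b)"
  proof (rule identity_transfer[OF pq e, where G = "\<lambda>x. map ?c (g x)"])
    show "map ?c (g x) \<noteq> []" for x using g expand_singletons_nonempty by blast
    show "\<forall>w\<in>expand (\<lambda>x. map ?c (g x)) p. lists_edge (map ?c a @ w @ map ?c b)"
      unfolding exG
    proof (clarify)
      fix s assume "s \<in> expand (\<lambda>x. [x]) p"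
      then have s: "a @ concat (map g s) @ b \<in> D" by (auto simp: D_def)
      with \<open>D \<subseteq> L\<close> L c(2) have "lists_edge (map ?c (a @ concat (map g s) @ b))"
        unfolding rainbow by blast
      then show "lists_edge (map ?c a @ map ?c (concat (map g s)) @ map ?c b)" by simp
    qed
    show "map ?c (concat (map g v)) \<in> expand (\<lambda>x. map ?c (g x)) q"
      unfolding exG using v by blast
  qed (use ce in blast)+
  with rainbow[of "a @ concat (map g v) @ b"] nc show False by simp
qed

section \<open>The separating identity\<close>

text \<open>If the images of a \<open>4\<close>-cycle of the graph were distinct, one hyperedge would contain them. It is
  the image of a hyperedge of the sparse hypergraph, which has only three vertices apart from those common to
  all hyperedges.\<close>

lemma no_homomorphism:
  assumes hom: "\<And>a. a \<in> arcs n \<Longrightarrow> distinct (map \<phi> (hyperedge_list k a)) \<and>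
    set (map \<phi> (hyperedge_list k a)) \<in> E"
  shows False
proof (rule quadrangle_obstruction)
  define h where "h a = set (map \<phi> (hyperedge_list k a))" for a
  define P where "P = (\<lambda>i. \<phi> (Pad i)) ` {..<k - 3}"
  have h: "h a = {\<phi> (fst a), \<phi> (snd a), \<phi> (Mid (fst a) (snd a))} \<union> P" for a
    by (auto simp: h_def P_def hyperedge_list_def)
  show neq: "\<phi> x \<noteq> \<phi> y" if "adjacent n x y" for x y
    using that hom[of "(x, y)"] hom[of "(y, x)"] by (auto simp: adjacent_def hyperedge_list_def)
  have edge: "\<exists>a\<in>arcs n. {\<phi> x, \<phi> y} \<subseteq> h a \<and> h a \<in> E \<and>
      {\<phi> x, \<phi> y} \<inter> P = {}" if xy: "adjacent n x y" for x y
  proof -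
    obtain a where a: "a \<in> arcs n" "a = (x, y) \<or> a = (y, x)" using xy by (auto simp: adjacent_def)
    have "{\<phi> x, \<phi> y} \<inter> P = {}"
      using hom[OF a(1)] a(2) by (auto simp: hyperedge_list_def P_def)
    moreover have "{\<phi> x, \<phi> y} \<subseteq> h a" using a(2) by (auto simp: h)
    ultimately show ?thesis using a(1) hom[OF a(1)] by (auto simp: h_def)
  qed
  show "\<phi> x = \<phi> z \<or> \<phi> y = \<phi> t"
    if xy: "adjacent n x y" and yz: "adjacent n y z" and zt: "adjacent n z t" and tx: "adjacent n t x"
    for x y z t
  proof (rule ccontr)
    assume "\<not> (\<phi> x = \<phi> z \<or> \<phi> y = \<phi> t)"
    then have dist: "distinct [\<phi> x, \<phi> y, \<phi> z, \<phi> t]"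
      using neq[OF xy] neq[OF yz] neq[OF zt] neq[OF tx] by auto
    obtain a1 where a1: "{\<phi> x, \<phi> y} \<subseteq> h a1" "h a1 \<in> E"
      "{\<phi> x, \<phi> y} \<inter> P = {}" using edge[OF xy] by blast
    obtain a2 where a2: "{\<phi> y, \<phi> z} \<subseteq> h a2" "h a2 \<in> E" using edge[OF yz] by blast
    obtain a3 where a3: "{\<phi> z, \<phi> t} \<subseteq> h a3" "h a3 \<in> E"
      "{\<phi> z, \<phi> t} \<inter> P = {}" using edge[OF zt] by blast
    obtain a4 where a4: "{\<phi> t, \<phi> x} \<subseteq> h a4" "h a4 \<in> E" using edge[OF tx] by blast
    have "{\<phi> z, \<phi> t} \<subseteq> h a1"
      using quadrangle[OF a1(2) a2(2) a3(2) a4(2) dist a1(1) a2(1) a3(1) a4(1)] .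
    with a1 a3(3) have "{\<phi> x, \<phi> y, \<phi> z, \<phi> t} \<subseteq> h a1 - P" by auto
    also have "\<dots> \<subseteq> {\<phi> (fst a1), \<phi> (snd a1), \<phi> (Mid (fst a1) (snd a1))}" by (auto simp: h)
    finally have "{\<phi> x, \<phi> y, \<phi> z, \<phi> t} \<subseteq> {\<phi> (fst a1), \<phi> (snd a1), \<phi> (Mid (fst a1) (snd a1))}" .
    then have "card {\<phi> x, \<phi> y, \<phi> z, \<phi> t} \<le> card {\<phi> (fst a1), \<phi> (snd a1), \<phi> (Mid (fst a1) (snd a1))}"
      by (intro card_mono) auto
    also have "\<dots> \<le> 3" by (simp add: card_insert_if)
    finally show False using dist by simp
  qed
qed

lemma length_le_concat_map:
  assumes "\<And>x. g x \<noteq> []"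
  shows "length xs \<le> length (concat (map g xs))"
proof (induction xs)
  case (Cons x xs)
  have "length (g x) \<ge> 1" using assms[of x] by (cases "g x") auto
  with Cons show ?case by simp
qed simp

text \<open>A product of \<open>k\<close> nonempty words that has at most \<open>k\<close> letters forces every factor to be
  a single letter.\<close>

lemma eval_sparse_hypergraph:
  assumes G: "\<And>x. G x \<in> words V" and nz: "w0 \<in> words V" "\<not> hcong V E w0 [Zero]"
    and t: "expand G t = (\<lambda>a. concat (map (\<lambda>v. G (code v)) (hyperedge_list k a))) ` arcs n"
  shows "eval S (\<lambda>x. cls (G x)) t \<noteq> cls w0"
proof
  assume "eval S (\<lambda>x. cls (G x)) t = cls w0"
  note ev = eval_nonzero[OF G this nz]
  let ?g = "\<lambda>v. G (code v)"
  have all: "\<exists>vs. concat (map ?g (hyperedge_list k a)) = map Gen vs \<and> distinct vs \<and> set vs \<in> E \<and>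
      (\<forall>v\<in>set (hyperedge_list k a). length (?g v) = 1)" if a: "a \<in> arcs n" for a
  proof -
    let ?w = "concat (map ?g (hyperedge_list k a))"
    have w: "?w \<in> expand G t" using a t by blast
    have "\<not> hcong V E ?w [Zero]" using ev[OF w] nz(2) by (blast intro: hcong.sym hcong.trans)
    then obtain vs e where vs: "?w = map Gen vs" "distinct vs" "e \<in> E" "set vs \<subseteq> e"
      using nonzero_word[OF expand_in_words[OF G w]] by blast
    have ne: "?g v \<noteq> []" for v using G by (simp add: words_def)
    have "length vs \<le> k"
      using vs edge_card[of e] card_mono[of e "set vs"] distinct_card[of vs] by simp
    then have len: "length ?w \<le> k" using vs(1) by (metis length_map)
    have lk: "length (hyperedge_list k a) = k" using length_hyperedge_list[OF k] .
    have one: "length (?g v) = 1" if v: "v \<in> set (hyperedge_list k a)" for v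
    proof -
      obtain p q where pq: "hyperedge_list k a = p @ v # q" using v by (meson split_list)
      have "length p \<le> length (concat (map ?g p))" "length q \<le> length (concat (map ?g q))"
        using length_le_concat_map[of ?g, OF ne] by blast+
      moreover have "length p + 1 + length q = k" using pq lk by simp
      moreover have "length (?g v) \<ge> 1" using ne[of v] by (cases "?g v") auto
      ultimately show ?thesis using len pq by simp
    qed
    have "length vs = k"
    proof -
      have "length (hyperedge_list k a) \<le> length ?w"
        using length_le_concat_map[of ?g, OF ne] by blast
      then show ?thesis using \<open>length vs \<le> k\<close> lk vs(1) by simp
    qed
    then have "set vs = e"
      using vs edge_card[of e] distinct_card[of vs] by (intro card_subset_eq) auto
    with vs one show ?thesis by blast
  qed
  define \<phi> where "\<phi> v = (THE u. ?g v = [Gen u])" for v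
  show False
  proof (rule no_homomorphism)
    fix a assume a: "a \<in> arcs n"
    obtain vs where vs: "concat (map ?g (hyperedge_list k a)) = map Gen vs" "distinct vs" "set vs \<in> E"
      and one: "\<And>v. v \<in> set (hyperedge_list k a) \<Longrightarrow> length (?g v) = 1"
      using all[OF a] by blast
    have "?g v = [Gen (\<phi> v)]" if v: "v \<in> set (hyperedge_list k a)" for v
    proof -
      obtain z where z: "?g v = [z]" using one[OF v] by (metis One_nat_def length_0_conv length_Suc_conv)
      have "set (?g v) \<subseteq> set (map Gen vs)" unfolding vs(1)[symmetric] using v by auto
      then obtain u where "z = Gen u" using z by auto
      then show ?thesis using z by (simp add: \<phi>_def)
    qed
    then have "map ?g (hyperedge_list k a) = map (\<lambda>v. [Gen (\<phi> v)]) (hyperedge_list k a)" by simp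
    then have "concat (map ?g (hyperedge_list k a)) = map Gen (map \<phi> (hyperedge_list k a))"
      by (simp only: concat_map_singleton) simp
    then have "map Gen (map \<phi> (hyperedge_list k a)) = map Gen vs" using vs(1) by simp
    then have "map \<phi> (hyperedge_list k a) = vs"
      by (subst (asm) inj_map_eq_map) (simp_all add: inj_def)
    then show "distinct (map \<phi> (hyperedge_list k a)) \<and> set (map \<phi> (hyperedge_list k a)) \<in> E"
      using vs by simp
  qed
qed

end

lemma add0_None: "add0 f x None = x"
  by (cases x) auto

lemma mul0_None: "mul0 f x None = None"
  by (cases x) auto

lemma algebra_adjoin_zero: "algebra A \<Longrightarrow> algebra (adjoin_zero A)"
  by (auto simp: algebra_def adjoin_zero_def)

lemma eval_adjoin_zero_Some:
  "(\<And>w x. w \<in> expand (\<lambda>x. [x]) t \<Longrightarrow> x \<in> set w \<Longrightarrow> h x = Some (g x)) \<Longrightarrow>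
    eval (adjoin_zero A) h t = Some (eval A g t)"
proof (induction t)
  case (Var x)
  then show ?case by simp
next
  case (Add s t)
  have "eval (adjoin_zero A) h s = Some (eval A g s)"
    by (rule Add.IH(1), rule Add.prems) auto
  moreover have "eval (adjoin_zero A) h t = Some (eval A g t)"
    by (rule Add.IH(2), rule Add.prems) auto
  ultimately show ?case by (simp add: adjoin_zero_def)
next
  case (Mul s t)
  obtain u v where uv: "u \<in> expand (\<lambda>x. [x]) s" "v \<in> expand (\<lambda>x. [x]) t"
    using expand_nonempty[of "\<lambda>x. [x]"] by blast
  have "eval (adjoin_zero A) h s = Some (eval A g s)"
  proof (rule Mul.IH(1))
    fix w x assume w: "w \<in> expand (\<lambda>x. [x]) s" "x \<in> set w"
    then have "w @ v \<in> expand (\<lambda>x. [x]) (Mul s t)" using uv(2) by auto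
    then show "h x = Some (g x)" by (rule Mul.prems) (simp add: w(2))
  qed
  moreover have "eval (adjoin_zero A) h t = Some (eval A g t)"
  proof (rule Mul.IH(2))
    fix w x assume w: "w \<in> expand (\<lambda>x. [x]) t" "x \<in> set w"
    then have "u @ w \<in> expand (\<lambda>x. [x]) (Mul s t)" using uv(1) by auto
    then show "h x = Some (g x)" by (rule Mul.prems) (simp add: w(2))
  qed
  ultimately show ?case by (simp add: adjoin_zero_def)
qed

lemma eval_adjoin_zero_None:
  "x \<in> set w \<Longrightarrow> h x = None \<Longrightarrow> eval (adjoin_zero A) h (product w) = None"
  by (induction w rule: product.induct) (auto simp: adjoin_zero_def mul0_None)

lemma identities_adjoin_zero: "identities_of (adjoin_zero A) \<subseteq> identities_of A"
proof
  fix p assume p: "p \<in> identities_of (adjoin_zero A)"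
  have "eval A h (fst p) = eval A h (snd p)" if h: "range h \<subseteq> carrier A" for h
  proof -
    have "range (\<lambda>x. Some (h x)) \<subseteq> carrier (adjoin_zero A)"
      using h by (auto simp: adjoin_zero_def)
    then have "eval (adjoin_zero A) (\<lambda>x. Some (h x)) (fst p) = eval (adjoin_zero A) (\<lambda>x. Some (h x)) (snd p)"
      using p unfolding identities_of_def satisfies_def by blast
    then show ?thesis by (simp add: eval_adjoin_zero_Some[where g = h])
  qed
  then show "p \<in> identities_of A" by (simp add: identities_of_def satisfies_def)
qed

context girth_gt_4_hypergraph
begin

text \<open>The added product contains every variable, so an assignment of the adjoined element to one of them
  makes it disappear from the sum. Its repeated letters keep it from being a listing.\<close>

lemma sparse_identity:
  assumes es: "set es = hyperedge_list k ` arcs n"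
    and ws: "ws = map (map to_nat) es" and w: "w = concat ws @ concat ws"
  shows "(sum_of_products ws, Add (sum_of_products ws) (product w)) \<in> identities_of (adjoin_zero S)"
proof -
  let ?t = "sum_of_products ws"
  have ne: "ws \<noteq> []" "[] \<notin> set ws"
    using es arcs_nonempty[of n] unfolding ws by (auto simp: hyperedge_list_def)
  then have "concat ws \<noteq> []" by (cases ws) auto
  then have w_ne: "w \<noteq> []" using w by simp
  have top: "eval S g ?t = cls [Zero]" if g: "range g \<subseteq> carrier S" for g
  proof -
    have "\<forall>x. \<exists>u. u \<in> words V \<and> g x = cls u" using g carrier_S by blast
    then obtain G where G: "\<And>x. G x \<in> words V" "g = (\<lambda>x. cls (G x))" by metis
    have "eval S g ?t \<in> carrier S" using eval_in_carrier[OF algebra_S g] .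
    then obtain w0 where w0: "w0 \<in> words V" "eval S g ?t = cls w0" using carrier_S by blast
    have "expand G ?t = (\<lambda>a. concat (map (\<lambda>v. G (to_nat v)) (hyperedge_list k a))) ` arcs n"
      using expand_sum_of_products[OF ne, of G] by (simp add: ws es image_image comp_def)
    then have "hcong V E w0 [Zero]"
      using eval_sparse_hypergraph[of G w0 ?t to_nat n, OF G(1) w0(1)] w0(2) G(2) by blast
    then show ?thesis using w0 cls_eq Zero_word by simp
  qed
  have "eval (adjoin_zero S) h ?t = eval (adjoin_zero S) h (Add ?t (product w))"
    if h: "range h \<subseteq> carrier (adjoin_zero S)" for h
  proof (cases "\<exists>x\<in>set w. h x = None")
    case True
    then have "eval (adjoin_zero S) h (product w) = None"
      using eval_adjoin_zero_None by blast
    then show ?thesis by (simp add: adjoin_zero_def add0_None)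
  next
    case False
    define g where "g x = (case h x of None \<Rightarrow> cls [Zero] | Some X \<Rightarrow> X)" for x
    have hg: "h x = Some (g x)" if "x \<in> set w" for x
      using False that by (auto simp: g_def split: option.splits)
    have "g x \<in> carrier S" for x
    proof -
      have "h x \<in> carrier (adjoin_zero S)" using h by blast
      then show ?thesis
        using Zero_word carrier_S by (auto simp: g_def adjoin_zero_def)
    qed
    then have g: "range g \<subseteq> carrier S" by blast
    have "eval (adjoin_zero S) h ?t = Some (eval S g ?t)"
    proof (rule eval_adjoin_zero_Some)
      fix u x assume "u \<in> expand (\<lambda>x. [x]) ?t" "x \<in> set u"
      then have "x \<in> set w" unfolding expand_sum_of_products[OF ne] w by auto
      then show "h x = Some (g x)" by (rule hg)
    qed
    moreover have "eval (adjoin_zero S) h (product w) = Some (eval S g (product w))"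
      using expand_product[OF w_ne, of "\<lambda>x. [x]"] hg by (intro eval_adjoin_zero_Some) auto
    ultimately show ?thesis using top[OF g] by (simp add: adjoin_zero_def add_S)
  qed
  then show ?thesis by (simp add: identities_of_def satisfies_def)
qed

text \<open>For \<open>A\<close> between \<open>S\<close> and \<open>S\<^sup>0\<close> with respect to identities, to treat both at once. The number \<open>n\<close>
  bounds the number of words on either side of every identity in \<open>\<Sigma>\<close>.\<close>

lemma not_finitely_based:
  assumes "infinite (UNIV :: 'u set)" "E \<noteq> {}" "algebra A" "identities_of A \<subseteq> identities_of S"
    and sub: "identities_of (adjoin_zero S) \<subseteq> identities_of A"
  shows "\<not> finitely_based TYPE('u) A"
proof (rule not_finitely_basedI[OF assms(1,3)])
  fix \<Sigma> assume \<Sigma>: "finite \<Sigma>" "\<Sigma> \<subseteq> identities_of A"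
  let ?X = "expand (\<lambda>x. [x])"
  define n where "n = (\<Sum>p\<in>\<Sigma>. card (?X (fst p)) + card (?X (snd p)))"
  let ?d = "from_nat :: nat \<Rightarrow> vert"
  let ?R = "word_congruence ?d (listings n k)"
  have L: "distinct w \<and> length w = k" if "w \<in> listings n k" for w
    using that listings_length[OF k that] by (simp add: listings_def)
  have half: "a @ w @ b \<in> listings n k"
    if "(p, q) \<in> identities_of S" "card (?X p) \<le> n"
      "\<forall>w\<in>expand (\<lambda>x. [?d x]) (subst \<theta> p). a @ w @ b \<in> listings n k"
      "w \<in> expand (\<lambda>x. [?d x]) (subst \<theta> q)" for p q \<theta> a b w
  proof (rule listing_context_transfer[OF that(1) assms(2) L _ that(3,4)])
    show "\<exists>c. range c \<subseteq> {..<k} \<and> (\<forall>w\<in>D. distinct (map c w)) \<and> \<not> (length u = k \<and> distinct (map c u))"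
      if "D \<subseteq> listings n k" "finite D" "card D \<le> card (?X p)" "u \<notin> listings n k" for D u
      using few_hyperedges_colourable[OF k that(1,2) _ that(4)] that(3) \<open>card (?X p) \<le> n\<close> by simp
  qed
  have inst: "?R (subst \<theta> (fst p)) (subst \<theta> (snd p))" if p: "p \<in> \<Sigma>" for p \<theta>
  proof -
    have "card (?X (fst p)) + card (?X (snd p)) \<le> n"
      unfolding n_def using \<Sigma>(1) p by (rule member_le_sum[rotated -1]) auto
    then have n: "card (?X (fst p)) \<le> n" "card (?X (snd p)) \<le> n" by simp_all
    have 1: "(fst p, snd p) \<in> identities_of S" using p \<Sigma>(2) assms(4) by auto
    then have 2: "(snd p, fst p) \<in> identities_of S" by (auto simp: identities_of_def satisfies_def)
    show ?thesis
      unfolding word_congruence_def using half[OF 1 n(1)] half[OF 2 n(2)] by blast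
  qed
  obtain as where as: "set as = arcs n" using finite_list[OF finite_arcs] by blast
  define es where "es = map (hyperedge_list k) as"
  define ws where "ws = map (map (to_nat :: vert \<Rightarrow> nat)) es"
  define w where "w = concat ws @ concat ws"
  let ?t = "sum_of_products ws"
  have es: "set es = hyperedge_list k ` arcs n" by (simp add: es_def as)
  have ne: "ws \<noteq> []" "[] \<notin> set ws"
    using es arcs_nonempty[of n] unfolding ws_def by (auto simp: hyperedge_list_def)
  have c_ne: "concat ws \<noteq> []" using ne by (cases ws) auto
  have single: "concat (map (\<lambda>x. [?d x]) v) = map ?d v" for v by (induction v) auto
  have "expand (\<lambda>x. [?d x]) ?t = hyperedge_list k ` arcs n"
    using expand_sum_of_products[OF ne, of "\<lambda>x. [?d x]"]
    by (simp add: single ws_def es image_image comp_def)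
  then have t_in: "\<forall>v\<in>expand (\<lambda>x. [?d x]) ?t. v \<in> listings n k"
    using hyperedge_list_in_listings by auto
  have "map ?d w \<in> expand (\<lambda>x. [?d x]) (Add ?t (product w))"
    using expand_product[of w "\<lambda>x. [?d x]"] single c_ne w_def by simp
  moreover have "\<not> distinct (map ?d w)"
    using c_ne by (cases "concat ws") (auto simp: w_def)
  ultimately have "\<not> (\<forall>v\<in>expand (\<lambda>x. [?d x]) (Add ?t (product w)). v \<in> listings n k)"
    using L by blast
  with t_in have "\<not> ?R ?t (Add ?t (product w))"
    unfolding word_congruence_def by (metis append_Nil append_Nil2)
  moreover have "(?t, Add ?t (product w)) \<in> identities_of A"
    using sparse_identity[OF es ws_def w_def] sub by blast
  ultimately show "\<exists>R. congruence R \<and> (\<forall>p\<in>\<Sigma>. \<forall>\<theta>. R (subst \<theta> (fst p)) (subst \<theta> (snd p))) \<and>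
      (\<exists>p\<in>identities_of A. \<not> R (fst p) (snd p))"
    using congruence_word_congruence[of ?d "listings n k"] inst
    by (intro exI[of _ ?R] conjI bexI[of _ "(?t, Add ?t (product w))"]) auto
qed

end

theorem corollary4p6:
  fixes V :: "'v set" and E :: "'v set set" and k :: nat
  assumes "infinite (UNIV :: 'u set)"
    and "k \<ge> 3"
    and "hypergraph V E"
    and "V \<noteq> {}"
    and "uniform k E"
    and "\<forall>v\<in>V. \<not> isolated E v"
    and "girth V E > 4"
  shows "\<not> finitely_based TYPE('u) (hypergraph_semiring V E) \<and>
         \<not> finitely_based TYPE('u) (adjoin_zero (hypergraph_semiring V E))"
proof -
  interpret girth_gt_4_hypergraph V E k
    using assms by unfold_locales
  have E: "E \<noteq> {}" using assms(4,6) by (auto simp: isolated_def)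
  show ?thesis
    using not_finitely_based[OF assms(1) E algebra_S order_refl identities_adjoin_zero]
      not_finitely_based[OF assms(1) E algebra_adjoin_zero[OF algebra_S] identities_adjoin_zero order_refl]
    by blast
qed

end
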